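(* Let $G$ be a finite simple graph each of whose components is the square of a path, the square of a cycle on at least $6$ vertices, or a copy of $K_4$. Then $G$ is equitably $4$-choosable. Moreover, $G$ is equitably $3$-choosable if and only if no component of $G$ is a copy of $K_4$ and every component of $G$ that is the square of a cycle has order (number of vertices) divisible by $3$.
   Context: The square $H^2$ of a graph $H$ has vertex set $V(H)$, with two distinct vertices adjacent if and only if their distance in $H$ is at most $2$. A path may consist of a single vertex. A $k$-assignment $L$ for a graph $G$ assigns to each vertex $v$ a set $L(v)$ of exactly $k$ colors. A proper $L$-coloring is a proper coloring $f$ with $f(v)\in L(v)$ for every $v$; it is equitable if each color is used on at most $\lceil |V(G)|/k\rceil$ vertices. $G$ is equitably $k$-choosable if it has an equitable $L$-coloring for every $k$-assignment $L$. *)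

theory Defs
  imports "Graph_Theory.Graph_Theory"
begin

text \<open>
  A finite simple graph is a \<^locale>\<open>pair_graph\<close>: each edge is represented by the two
  opposite arcs between its ends.
\<close>

text \<open>\<^term>\<open>wf_digraph.\<mu> H (\<lambda>_. 1) u v\<close> is the distance from \<open>u\<close> to \<open>v\<close> in \<open>H\<close>
  (\<open>\<infinity>\<close> if \<open>v\<close> is unreachable from \<open>u\<close>).\<close>

definition graph_square :: "'a pair_pre_digraph \<Rightarrow> 'a pair_pre_digraph" where
  "graph_square H = \<lparr> pverts = pverts H,
     parcs = {(u, v). u \<in> pverts H \<and> v \<in> pverts H \<and> u \<noteq> v \<and>
                      wf_digraph.\<mu> (with_proj H) (\<lambda>_. 1) u v \<le> 2} \<rparr>"

definition path_graph :: "nat \<Rightarrow> nat pair_pre_digraph" where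
  "path_graph n = \<lparr> pverts = {..<n},
     parcs = {(i, j). i < n \<and> j < n \<and> (j = i + 1 \<or> i = j + 1)} \<rparr>"

text \<open>A cycle, and in particular a simple graph, only for \<open>n \<ge> 3\<close>.\<close>

definition cycle_graph :: "nat \<Rightarrow> nat pair_pre_digraph" where
  "cycle_graph n = \<lparr> pverts = {..<n},
     parcs = {(i, j). i < n \<and> j < n \<and> (j = (i + 1) mod n \<or> i = (j + 1) mod n)} \<rparr>"

definition is_path_square :: "('a, 'b) pre_digraph \<Rightarrow> bool" where
  "is_path_square C \<longleftrightarrow> (\<exists>n\<ge>1. digraph_iso (with_proj (graph_square (path_graph n))) C)"

definition is_cycle_square :: "nat \<Rightarrow> ('a, 'b) pre_digraph \<Rightarrow> bool" where
  "is_cycle_square n C \<longleftrightarrow> n \<ge> 3 \<and> digraph_iso (with_proj (graph_square (cycle_graph n))) C"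

definition components :: "'a pair_pre_digraph \<Rightarrow> ('a, 'a \<times> 'a) pre_digraph set" where
  "components G = {C. pre_digraph.max_subgraph (with_proj G) Digraph_Component.connected C}"

text \<open>Since only finitely many colors occur on a finite graph, taking natural numbers
  as colors is no restriction.\<close>

definition k_assignment :: "'a pair_pre_digraph \<Rightarrow> nat \<Rightarrow> ('a \<Rightarrow> nat set) \<Rightarrow> bool" where
  "k_assignment G k L \<longleftrightarrow> (\<forall>v\<in>pverts G. finite (L v) \<and> card (L v) = k)"

definition proper_list_coloring ::
    "'a pair_pre_digraph \<Rightarrow> ('a \<Rightarrow> nat set) \<Rightarrow> ('a \<Rightarrow> nat) \<Rightarrow> bool" where
  "proper_list_coloring G L f \<longleftrightarrow>
     (\<forall>(u, v)\<in>parcs G. f u \<noteq> f v) \<and> (\<forall>v\<in>pverts G. f v \<in> L v)"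

definition equitable :: "'a pair_pre_digraph \<Rightarrow> nat \<Rightarrow> ('a \<Rightarrow> nat) \<Rightarrow> bool" where
  "equitable G k f \<longleftrightarrow>
     (\<forall>c. int (card {v \<in> pverts G. f v = c}) \<le> \<lceil>real (card (pverts G)) / real k\<rceil>)"

definition equitably_choosable :: "'a pair_pre_digraph \<Rightarrow> nat \<Rightarrow> bool" where
  "equitably_choosable G k \<longleftrightarrow>
     (\<forall>L. k_assignment G k L \<longrightarrow> (\<exists>f. proper_list_coloring G L f \<and> equitable G k f))"

end

theory Submission
  imports Defs
begin

text \<open>
  Color the components one after another, cutting the vertices into consecutive blocks of \<open>k\<close>, where
  a block may straddle two components, and insist that each block is rainbow: then no color is used
  more than once per block, hence at most \<open>\<lceil>|V(G)|/k\<rceil>\<close> times. It therefore suffices to extend a partial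
  block of at most \<open>k - 1\<close> colored vertices to one further component.

  For the square of a path and for \<open>K\<^sub>4\<close> this is done greedily, as every vertex has at most \<open>k - 1\<close> earlier
  neighbors. For the square of a cycle and \<open>k = 4\<close>, color the first two vertices, then proceed greedily
  to the end of a block that leaves between one and four vertices. A careful choice of the color of
  the last vertex of that block leaves lists on the remaining vertices that have a system of distinct
  representatives. Cycles of length 6, and of length 7 in one case, are too short for this.

  For \<open>k = 3\<close> and a cycle of length \<open>3m\<close>, every proper coloring uses each color at most \<open>m\<close>
  times, so it suffices that its square is 3-choosable, which follows from the Combinatorial
  Nullstellensatz. Conversely, along the square of a cycle a proper 3-coloring must have period 3.
\<close>

text \<open>A component can be entered with any number \<open>p < 4\<close> of inherited colors, so
  the cycle argument has to work for each of them. Closing the cycle costs the last vertices up to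
  two further colors. When three or four vertices remain, the sizes of the reduced lists alone do
  not give Hall's condition: the two longest of the lists that are used may coincide. A color
  \<open>c\<close> with two admissible values repairs this, since two different deletions cannot
  both leave the union of these two lists too small. When \<open>n = 6\<close>, or
  \<open>n = 7\<close> and \<open>p = 1\<close>, the block ending at \<open>c\<close> holds so many
  fixed colors that \<open>c\<close> has too few candidates. There the vertices are colored in
  another order, except for \<open>n = 6\<close>, \<open>p = 1\<close>: then the inherited color is
  deleted from every list, and 3-choosability of the square, proved for \<open>k = 3\<close>, is
  reused.\<close>

section \<open>The square of a cycle of length divisible by 3\<close>

text \<open>For \<open>a\<close> in \<open>A\<close> this is the derivative at \<open>a\<close> of
  the monic polynomial with root set \<open>A\<close>, the denominator in Lagrange interpolation at
  the nodes \<open>A\<close>.\<close>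

definition node_deriv :: "real set \<Rightarrow> real \<Rightarrow> real" where
  "node_deriv A a = (\<Prod>b\<in>A - {a}. a - b)"

text \<open>The sum is the divided difference of \<open>x ^ e\<close> at three nodes, that is, the
  coefficient of \<open>x ^ 2\<close> in its interpolation polynomial, which is \<open>x ^ e\<close>
  itself.\<close>

lemma sum_power_div_node_deriv:
  assumes "card A = 3" "e \<le> 2"
  shows "(\<Sum>a\<in>A. a ^ e / node_deriv A a) = (if e = 2 then 1 else 0)"
proof -
  obtain p q r where A: "A = {p, q, r}" and ne: "p \<noteq> q" "p \<noteq> r" "q \<noteq> r"
    using assms(1) by (auto simp: card_3_iff)
  have d: "node_deriv A p = (p - q) * (p - r)" "node_deriv A q = (q - p) * (q - r)"
    "node_deriv A r = (r - p) * (r - q)"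
    using ne unfolding node_deriv_def A by (auto simp: insert_Diff_if)
  have s: "(\<Sum>a\<in>A. a ^ e / node_deriv A a) =
    p ^ e / ((p - q) * (p - r)) + q ^ e / ((q - p) * (q - r)) + r ^ e / ((r - p) * (r - q))"
    using ne by (simp add: d[symmetric]) (simp add: A)
  consider "e = 0" | "e = 1" | "e = 2" using assms(2) by linarith
  then show ?thesis
    unfolding s using ne
    by cases (simp_all add: divide_simps, (simp add: algebra_simps power2_eq_square)+)
qed

text \<open>The sum factors into one-variable sums. The exponents average 2, so unless all equal 2
  some exponent is below 2 and its factor vanishes; factors with larger exponents never have to be
  evaluated.\<close>

lemma sum_PiE_monomial:
  fixes A :: "'i \<Rightarrow> real set"
  assumes "finite I" "\<And>i. i \<in> I \<Longrightarrow> card (A i) = 3" "sum e I = 2 * card I"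
  shows "(\<Sum>x\<in>PiE I A. (\<Prod>i\<in>I. x i ^ e i) / (\<Prod>i\<in>I. node_deriv (A i) (x i))) =
    (if \<forall>i\<in>I. e i = 2 then 1 else 0)"
proof -
  have fin: "finite (A i)" if "i \<in> I" for i
    using assms(2)[OF that] by (intro card_ge_0_finite) simp
  have "(\<Sum>x\<in>PiE I A. (\<Prod>i\<in>I. x i ^ e i) / (\<Prod>i\<in>I. node_deriv (A i) (x i))) =
    (\<Sum>x\<in>PiE I A. \<Prod>i\<in>I. x i ^ e i / node_deriv (A i) (x i))"
    by (simp add: prod_dividef)
  also have "\<dots> = (\<Prod>i\<in>I. \<Sum>a\<in>A i. a ^ e i / node_deriv (A i) a)"
    using assms(1) fin by (intro prod_sum_PiE[symmetric]) auto
  also have "\<dots> = (if \<forall>i\<in>I. e i = 2 then 1 else 0)"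
  proof (cases "\<forall>i\<in>I. e i = 2")
    case True
    then show ?thesis using assms(2) by (simp add: sum_power_div_node_deriv)
  next
    case False
    have "\<exists>i\<in>I. e i < 2"
    proof (rule ccontr)
      assume "\<not> ?thesis"
      then have ge: "\<forall>i\<in>I. 2 \<le> e i" by force
      with False obtain j where "j \<in> I" "2 < e j" by force
      then have "(\<Sum>i\<in>I. 2) < sum e I" using ge assms(1) by (intro sum_strict_mono_ex1) auto
      then show False using assms(3) by simp
    qed
    then obtain i where "i \<in> I" "e i < 2" by blast
    then have "(\<Sum>a\<in>A i. a ^ e i / node_deriv (A i) a) = 0"
      using assms(2) by (subst sum_power_div_node_deriv) auto
    then show ?thesis using False \<open>i \<in> I\<close> assms(1) by (auto intro: prod_zero)
  qed
  finally show ?thesis .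
qed

text \<open>Each \<open>B\<close> is an orientation of the edges: it records which factors
  contribute the end \<open>s e\<close>. Equal monomials are deliberately not collected, so no
  polynomial type is needed.\<close>

lemma prod_differences_expand:
  fixes x :: "'i \<Rightarrow> real"
  assumes "finite E"
  shows "(\<Prod>e\<in>E. x (s e) - x (t e)) =
    (\<Sum>B\<in>Pow E. (-1) ^ card (E - B) * (\<Prod>e\<in>E. x (if e \<in> B then s e else t e)))"
proof -
  have "(\<Prod>e\<in>E. x (s e) - x (t e)) = (\<Prod>e\<in>E. x (s e) + (-1) * x (t e))" by simp
  also have "\<dots> = (\<Sum>B\<in>Pow E. (\<Prod>e\<in>B. x (s e)) * (\<Prod>e\<in>E-B. (-1) * x (t e)))"
    using assms by (rule prod_add)
  also have "\<dots> = (\<Sum>B\<in>Pow E. (-1) ^ card (E - B) * (\<Prod>e\<in>E. x (if e \<in> B then s e else t e)))"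
  proof (rule sum.cong)
    fix B assume "B \<in> Pow E"
    then have B: "B \<subseteq> E" by simp
    have "(\<Prod>e\<in>E. x (if e \<in> B then s e else t e)) = (\<Prod>e\<in>B. x (s e)) * (\<Prod>e\<in>E-B. x (t e))"
      by (subst prod.subset_diff[OF B assms]) (simp add: mult.commute)
    then show "(\<Prod>e\<in>B. x (s e)) * (\<Prod>e\<in>E-B. (-1) * x (t e)) =
      (-1) ^ card (E - B) * (\<Prod>e\<in>E. x (if e \<in> B then s e else t e))"
      by (simp add: prod.distrib prod_uminus)
  qed simp
  finally show ?thesis .
qed

text \<open>Combinatorial Nullstellensatz: by \<open>sum_PiE_monomial\<close>, either side is the coefficient of
  \<open>\<Prod>i\<in>I. x i ^ 2\<close> in the edge polynomial.\<close>

lemma sum_PiE_prod_differences_eq: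
  fixes A A' :: "'i \<Rightarrow> real set"
  assumes "finite I" "finite E" "card E = 2 * card I" "s ` E \<subseteq> I" "t ` E \<subseteq> I"
    and "\<And>i. i \<in> I \<Longrightarrow> card (A i) = 3" "\<And>i. i \<in> I \<Longrightarrow> card (A' i) = 3"
  shows "(\<Sum>x\<in>PiE I A. (\<Prod>e\<in>E. x (s e) - x (t e)) / (\<Prod>i\<in>I. node_deriv (A i) (x i))) =
    (\<Sum>x\<in>PiE I A'. (\<Prod>e\<in>E. x (s e) - x (t e)) / (\<Prod>i\<in>I. node_deriv (A' i) (x i)))"
proof -
  \<comment> \<open>\<open>d B i\<close> is the exponent of \<open>x i\<close> in the monomial
    selected by \<open>B\<close>.\<close>
  define d where "d B i = card {e \<in> E. (if e \<in> B then s e else t e) = i}" for B i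
  have in_I: "(\<lambda>e. if e \<in> B then s e else t e) ` E \<subseteq> I" for B
    using assms(4,5) by auto
  have mono: "(\<Prod>e\<in>E. x (if e \<in> B then s e else t e)) = (\<Prod>i\<in>I. x i ^ d B i)" for B and x :: "'i \<Rightarrow> real"
  proof -
    have "(\<Prod>i\<in>I. \<Prod>e\<in>{e \<in> E. (if e \<in> B then s e else t e) = i}. x (if e \<in> B then s e else t e)) =
      (\<Prod>e\<in>E. x (if e \<in> B then s e else t e))"
      by (rule prod.group[OF assms(2,1) in_I])
    moreover have "(\<Prod>e\<in>{e \<in> E. (if e \<in> B then s e else t e) = i}. x (if e \<in> B then s e else t e)) = x i ^ d B i" for i
      unfolding d_def by (subst prod_constant[symmetric]) (rule prod.cong, auto)
    ultimately show ?thesis by simp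
  qed
  have deg: "sum (d B) I = 2 * card I" for B
  proof -
    have "sum (d B) I = (\<Sum>i\<in>I. \<Sum>e\<in>{e \<in> E. (if e \<in> B then s e else t e) = i}. 1)"
      unfolding d_def by simp
    also have "\<dots> = (\<Sum>e\<in>E. 1)" by (rule sum.group[OF assms(2,1) in_I])
    finally show ?thesis using assms(3) by simp
  qed
  have "(\<Sum>x\<in>PiE I C. (\<Prod>e\<in>E. x (s e) - x (t e)) / (\<Prod>i\<in>I. node_deriv (C i) (x i))) =
    (\<Sum>B\<in>Pow E. (-1) ^ card (E - B) * (if \<forall>i\<in>I. d B i = 2 then 1 else 0))"
    if C: "\<And>i. i \<in> I \<Longrightarrow> card (C i) = 3" for C :: "'i \<Rightarrow> real set"
  proof -
    have "(\<Sum>x\<in>PiE I C. (\<Prod>e\<in>E. x (s e) - x (t e)) / (\<Prod>i\<in>I. node_deriv (C i) (x i))) =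
      (\<Sum>x\<in>PiE I C. \<Sum>B\<in>Pow E. (-1) ^ card (E - B) *
         ((\<Prod>i\<in>I. x i ^ d B i) / (\<Prod>i\<in>I. node_deriv (C i) (x i))))"
      by (simp only: prod_differences_expand[OF assms(2)] mono sum_divide_distrib times_divide_eq_right)
    also have "\<dots> = (\<Sum>B\<in>Pow E. (-1) ^ card (E - B) *
        (\<Sum>x\<in>PiE I C. (\<Prod>i\<in>I. x i ^ d B i) / (\<Prod>i\<in>I. node_deriv (C i) (x i))))"
      by (subst sum.swap) (simp only: sum_distrib_left)
    also have "\<dots> = (\<Sum>B\<in>Pow E. (-1) ^ card (E - B) * (if \<forall>i\<in>I. d B i = 2 then 1 else 0))"
      by (simp only: sum_PiE_monomial[OF assms(1) C deg])
    finally show ?thesis .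
  qed
  from this[of A] this[of A'] assms(6,7) show ?thesis by simp
qed

text \<open>The coefficient is never computed. It is compared with the weighted sum for the lists
  \<open>{0, 1, 2}\<close>, where every improper choice contributes 0 and every proper coloring
  contributes 1; since \<open>3 dvd n\<close>, the coloring \<open>i mod 3\<close> makes this sum
  positive. Hence the sum for the given lists has a nonzero term.\<close>

lemma cycle_square_3_choosable:
  fixes L :: "nat \<Rightarrow> nat set"
  assumes "3 dvd n" "n > 0" "\<And>i. i < n \<Longrightarrow> card (L i) = 3"
  shows "\<exists>f. \<forall>i<n. f i \<in> L i \<and> f i \<noteq> f ((i + 1) mod n) \<and> f i \<noteq> f ((i + 2) mod n)"
proof -
  define I where "I = {..<n}"
  \<comment> \<open>Indexing the factors by vertex and step length gives exactly
    \<open>2 * n\<close> of them, the degree of the target monomial; for \<open>n = 3\<close> every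
    edge is counted twice.\<close>
  define E where "E = I \<times> {1, 2 :: nat}"
  define s t :: "nat \<times> nat \<Rightarrow> nat" where "s e = fst e" and "t e = (fst e + snd e) mod n" for e
  define A A' :: "nat \<Rightarrow> real set" where "A i = real ` L i" and "A' i = {0, 1, 2}" for i
  define P where "P x = (\<Prod>e\<in>E. x (s e) - x (t e))" for x :: "nat \<Rightarrow> real"
  have fI: "finite I" and fE: "finite E" unfolding I_def E_def by auto
  have cE: "card E = 2 * card I" unfolding E_def by (simp add: card_cartesian_product)
  have st: "s ` E \<subseteq> I" "t ` E \<subseteq> I" using assms(2) unfolding s_def t_def E_def I_def by auto
  have cA: "card (A i) = 3" if "i \<in> I" for i
    using assms(3) that unfolding A_def I_def by (simp add: card_image)
  have cA': "card (A' i) = 3" for i unfolding A'_def by simp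
  have P_alt: "P x = (\<Prod>i\<in>I. (x i - x ((i + 1) mod n)) * (x i - x ((i + 2) mod n)))" for x
  proof -
    have "P x = (\<Prod>(i, k)\<in>I \<times> {1, 2}. x i - x ((i + k) mod n))"
      unfolding P_def E_def s_def t_def by (rule prod.cong) auto
    also have "\<dots> = (\<Prod>i\<in>I. \<Prod>k\<in>{1, 2}. x i - x ((i + k) mod n))"
      by (rule prod.cartesian_product[symmetric])
    finally show ?thesis by simp
  qed
  \<comment> \<open>A zero-free term is a proper coloring with colors 0, 1, 2; then the two out-neighbours of
    a vertex carry the two other colours, and numerator and denominator agree factor by factor.\<close>
  have summand: "P x / (\<Prod>i\<in>I. node_deriv (A' i) (x i)) \<in> {0, 1}" if x: "x \<in> PiE I A'" for x
  proof (cases "P x = 0")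
    case False
    have "(x i - x ((i + 1) mod n)) * (x i - x ((i + 2) mod n)) = node_deriv (A' i) (x i) \<and> node_deriv (A' i) (x i) \<noteq> 0" if i: "i \<in> I" for i
    proof -
      define j k where "j = (i + 1) mod n" and "k = (i + 2) mod n"
      have jI: "j \<in> I" "k \<in> I" using assms(2) unfolding j_def k_def I_def by auto
      have k: "k = (j + 1) mod n" unfolding j_def k_def by (simp add: mod_simps)
      have "x i \<noteq> x j" "x i \<noteq> x k" "x j \<noteq> x k"
        using False i jI fI k unfolding P_alt j_def k_def by (auto simp: prod_zero_iff)
      moreover have "x i \<in> {0,1,2}" "x j \<in> {0,1,2}" "x k \<in> {0,1,2}"
        using x i jI unfolding A'_def by (auto simp: PiE_iff)
      ultimately show ?thesis
        unfolding j_def[symmetric] k_def[symmetric]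
        by (auto simp: node_deriv_def A'_def insert_Diff_if)
    qed
    then have "P x = (\<Prod>i\<in>I. node_deriv (A' i) (x i))" "(\<Prod>i\<in>I. node_deriv (A' i) (x i)) \<noteq> 0"
      unfolding P_alt by (auto simp: prod_zero_iff fI)
    then show ?thesis by simp
  qed simp
  define x0 :: "nat \<Rightarrow> real" where "x0 = restrict (\<lambda>i. real (i mod 3)) I"
  have x0: "x0 \<in> PiE I A'"
  proof -
    have "real (i mod 3) \<in> {0, 1, 2}" for i
    proof -
      have "i mod 3 < 3" by simp
      then consider "i mod 3 = 0" | "i mod 3 = 1" | "i mod 3 = 2" by linarith
      then show ?thesis by cases auto
    qed
    then show ?thesis unfolding x0_def A'_def by auto
  qed
  have "P x0 \<noteq> 0"
  proof -
    have m: "((i + a) mod n) mod 3 = (i + a) mod 3" for i a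
      using assms(1) by (rule mod_mod_cancel)
    have "i mod 3 \<noteq> (i + 1) mod 3 \<and> i mod 3 \<noteq> (i + 2) mod 3" for i :: nat by presburger
    then show ?thesis
      using assms(2) unfolding P_alt x0_def I_def by (auto simp: prod_zero_iff m m[of _ 1, simplified] simp del: add_2_eq_Suc')
  qed
  have "0 < (\<Sum>x\<in>PiE I A'. P x / (\<Prod>i\<in>I. node_deriv (A' i) (x i)))"
  proof (rule sum_pos2[OF _ x0])
    show "finite (PiE I A')" using fI unfolding A'_def by (intro finite_PiE) auto
    have "P x0 / (\<Prod>i\<in>I. node_deriv (A' i) (x0 i)) \<noteq> 0"
    proof -
      have "node_deriv (A' i) a \<noteq> 0" for i a unfolding node_deriv_def A'_def by (auto simp: prod_zero_iff)
      then show ?thesis using \<open>P x0 \<noteq> 0\<close> fI by (auto simp: prod_zero_iff)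
    qed
    then show "0 < P x0 / (\<Prod>i\<in>I. node_deriv (A' i) (x0 i))" using summand[OF x0] by auto
  qed (use summand in fastforce)
  then have "(\<Sum>x\<in>PiE I A. P x / (\<Prod>i\<in>I. node_deriv (A i) (x i))) \<noteq> 0"
    unfolding P_def
    by (subst sum_PiE_prod_differences_eq[where A' = A', OF fI fE cE st cA cA']) auto
  then obtain x where x: "x \<in> PiE I A" "P x \<noteq> 0"
    by (metis (mono_tags, lifting) div_0 sum.neutral)
  define f where "f i = nat \<lfloor>x i\<rfloor>" for i
  have fx: "f i \<in> L i \<and> real (f i) = x i" if "i < n" for i
  proof -
    have "x i \<in> real ` L i" using x(1) that unfolding A_def I_def by (auto simp: PiE_iff)
    then show ?thesis unfolding f_def by auto
  qed
  have "x i \<noteq> x ((i + 1) mod n) \<and> x i \<noteq> x ((i + 2) mod n)" if "i < n" for i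
    using x(2) that fI unfolding P_alt by (auto simp: prod_zero_iff I_def)
  then have "\<forall>i<n. f i \<in> L i \<and> f i \<noteq> f ((i + 1) mod n) \<and> f i \<noteq> f ((i + 2) mod n)"
    using fx assms(2) by (metis mod_less_divisor)
  then show ?thesis by blast
qed

section \<open>Systems of distinct colors and greedy colorings\<close>

lemma ex_not_in:
  assumes "finite B" "card B < card A"
  shows "\<exists>c\<in>A. c \<notin> B"
  using assms by (meson card_mono leD subsetI)

lemma card_Diff_ge:
  assumes "k + card B \<le> card A" "finite B"
  shows "k \<le> card (A - B)"
  using diff_card_le_card_Diff[OF assms(2), of A] assms(1) by linarith

lemma ex_distinct_pair:
  assumes "A \<noteq> {}" "B \<noteq> {}" "2 \<le> card (A \<union> B)"
  shows "\<exists>a\<in>A. \<exists>b\<in>B. a \<noteq> b"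
proof (rule ccontr)
  assume *: "\<not> ?thesis"
  obtain c where "c \<in> A" using assms(1) by blast
  with * assms(2) have "c \<in> B" "B \<subseteq> {c}" by auto
  with * have "A \<union> B \<subseteq> {c}" by auto
  then have "card (A \<union> B) \<le> 1" using card_mono[of "{c}" "A \<union> B"] by simp
  then show False using assms(3) by simp
qed

text \<open>The bound on the union supplies what the sizes miss in Hall's condition. Removing any
  \<open>a\<close> from \<open>A\<close> costs every other set, and the union, at most one color,
  which reduces to the case of two sets.\<close>

lemma ex_distinct_triple:
  assumes "1 \<le> card A" "2 \<le> card B" "2 \<le> card C" "3 \<le> card (B \<union> C)"
  shows "\<exists>a\<in>A. \<exists>b\<in>B. \<exists>c\<in>C. a \<noteq> b \<and> a \<noteq> c \<and> b \<noteq> c"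
proof -
  obtain a where a: "a \<in> A" using assms(1) by fastforce
  have "B - {a} \<noteq> {}" "C - {a} \<noteq> {}"
    using card_Diff_ge[of 1 "{a}" B] card_Diff_ge[of 1 "{a}" C] assms by (force, force)
  moreover have "2 \<le> card ((B - {a}) \<union> (C - {a}))"
    using card_Diff_ge[of 2 "{a}" "B \<union> C"] assms by (simp add: Un_Diff)
  ultimately obtain b c where "b \<in> B - {a}" "c \<in> C - {a}" "b \<noteq> c" using ex_distinct_pair by metis
  then show ?thesis using a by (intro bexI[of _ a] bexI[of _ b] bexI[of _ c]) auto
qed

text \<open>The same reduction one level up. The sizes 1, 2, 3, 3 are those of the lists left on a
  final block of four.\<close>

lemma ex_distinct_quadruple:
  assumes "1 \<le> card A" "2 \<le> card B" "3 \<le> card C" "3 \<le> card D" "4 \<le> card (C \<union> D)"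
  shows "\<exists>a\<in>A. \<exists>b\<in>B. \<exists>c\<in>C. \<exists>d\<in>D. a \<noteq> b \<and> a \<noteq> c \<and> a \<noteq> d \<and> b \<noteq> c \<and> b \<noteq> d \<and> c \<noteq> d"
proof -
  obtain a where a: "a \<in> A" using assms(1) by fastforce
  have "1 \<le> card (B - {a})" "2 \<le> card (C - {a})" "2 \<le> card (D - {a})"
    using assms by (auto intro!: card_Diff_ge)
  moreover have "3 \<le> card ((C - {a}) \<union> (D - {a}))"
    using card_Diff_ge[of 3 "{a}" "C \<union> D"] assms by (simp add: Un_Diff)
  ultimately obtain b c d where "b \<in> B - {a}" "c \<in> C - {a}" "d \<in> D - {a}"
    "b \<noteq> c" "b \<noteq> d" "c \<noteq> d"
    using ex_distinct_triple[of "B - {a}" "C - {a}" "D - {a}"] by blast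
  then show ?thesis using a by (intro bexI[of _ a] bexI[of _ b] bexI[of _ c] bexI[of _ d]) auto
qed

text \<open>If both unions had at most \<open>k\<close> elements, both would equal \<open>Y\<close>;
  then \<open>Y\<close> would contain \<open>X - {d1}\<close> and \<open>X - {d2}\<close>, hence all
  of \<open>X\<close>, which is larger. This turns two candidates for a color into one that secures
  the union bound in Hall's condition.\<close>

lemma card_Diff_Un_gr:
  assumes "finite X" "finite Y" "k < card X" "k \<le> card Y" "d1 \<noteq> d2"
  shows "k < card ((X - {d1}) \<union> Y) \<or> k < card ((X - {d2}) \<union> Y)"
proof (rule ccontr)
  assume a: "\<not> ?thesis"
  have "Y = (X - {d}) \<union> Y" if "card ((X - {d}) \<union> Y) \<le> k" for d
    by (rule card_subset_eq) (use assms that card_mono[of "(X - {d}) \<union> Y" Y] in auto)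
  then have "X - {d1} \<subseteq> Y" "X - {d2} \<subseteq> Y" using a by (metis not_less sup.orderI sup_commute Un_upper1)+
  then have "X \<subseteq> Y" using assms(5) by blast
  moreover have "card Y \<le> k" using a assms(1,2) card_mono[of "(X - {d1}) \<union> Y" Y] by auto
  ultimately show False using assms card_mono[of Y X] by linarith
qed

lemma ex_card_Diff_Un_gr:
  assumes "2 \<le> card S" "finite X" "finite Y" "k < card X" "k \<le> card Y"
  shows "\<exists>d\<in>S. k < card ((X - {d}) \<union> Y)"
proof -
  obtain d1 where d1: "d1 \<in> S" using assms(1) by fastforce
  obtain d2 where d2: "d2 \<in> S" "d1 \<noteq> d2" using ex_not_in[of "{d1}" S] assms(1) by auto
  from card_Diff_Un_gr[OF assms(2-5) d2(2)] d1 d2 show ?thesis by blast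
qed

text \<open>Only \<open>card Z = k\<close> is critical, and then \<open>S\<close> is too large to be
  contained in \<open>Z\<close>.\<close>

lemma ex_card_Diff_ge:
  assumes "k < card S" "k \<le> card Z" "finite Z"
  shows "\<exists>d\<in>S. k \<le> card (Z - {d})"
proof (cases "card Z = k")
  case True
  then obtain d where "d \<in> S" "d \<notin> Z" using ex_not_in[of Z S] assms by auto
  then show ?thesis using assms(2) by (intro bexI[of _ d]) simp_all
next
  case False
  then have "k \<le> card (Z - {d})" for d using assms by (intro card_Diff_ge) auto
  moreover have "S \<noteq> {}" using assms by auto
  ultimately show ?thesis by blast
qed

text \<open>Any \<open>k\<close> consecutive positions become rainbow. This serves two purposes at
  once: it covers every block, wherever the cuts fall, and every edge whose ends are fewer than
  \<open>k\<close> positions apart.\<close>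

lemma greedy_coloring:
  fixes d :: "nat \<Rightarrow> nat"
  assumes "p < k" "inj_on d {..<p}" "p \<le> N" "\<And>j. p \<le> j \<Longrightarrow> j < N \<Longrightarrow> card (M j) = k"
  shows "\<exists>g. (\<forall>i<p. g i = d i) \<and> (\<forall>j. p \<le> j \<longrightarrow> j < N \<longrightarrow> g j \<in> M j) \<and>
    (\<forall>i j. i < j \<longrightarrow> j < N \<longrightarrow> j < i + k \<longrightarrow> g i \<noteq> g j)"
  using assms(3,4)
proof (induction N rule: dec_induct)
  case base
  have "d i \<noteq> d j" if "i < j" "j < p" for i j using inj_onD[OF assms(2), of i j] that by auto
  then show ?case by (intro exI[of _ d]) auto
next
  case (step N)
  then obtain g where g: "\<forall>i<p. g i = d i" "\<forall>j. p \<le> j \<longrightarrow> j < N \<longrightarrow> g j \<in> M j"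
    "\<forall>i j. i < j \<longrightarrow> j < N \<longrightarrow> j < i + k \<longrightarrow> g i \<noteq> g j" by auto
  have "card (g ` {N + 1 - k..<N}) \<le> card {N + 1 - k..<N}" by (rule card_image_le) simp
  also have "\<dots> < k" using assms(1) by auto
  finally obtain c where c: "c \<in> M N" "c \<notin> g ` {N + 1 - k..<N}"
    using ex_not_in[of "g ` {N + 1 - k..<N}" "M N"] step by auto
  have "g i \<noteq> c" if "i < N" "N < i + k" for i
  proof -
    have "i \<in> {N + 1 - k..<N}" using that by auto
    then show ?thesis using c(2) by blast
  qed
  then show ?case
    using g c(1) step(1) by (intro exI[of _ "g(N := c)"]) (auto simp: less_Suc_eq)
qed

text \<open>
  Vertices are addressed by positions. The positions \<open>0, \<dots>, p - 1\<close> stand for the \<open>p\<close> colors of the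
  block left incomplete by the preceding components, and vertex \<open>i\<close> sits at position \<open>p + i\<close>, so that
  blocks are the fibers of \<open>\<lambda>i. i div 4\<close>.
\<close>

definition block_adj :: "nat \<Rightarrow> nat \<Rightarrow> bool" where
  "block_adj i j \<longleftrightarrow> i < j \<and> (j \<le> i + 2 \<or> i div 4 = j div 4)"

definition block_proper :: "nat \<Rightarrow> (nat \<Rightarrow> nat) \<Rightarrow> bool" where
  "block_proper N g \<longleftrightarrow> (\<forall>i j. block_adj i j \<longrightarrow> j < N \<longrightarrow> g i \<noteq> g j)"

lemma block_proper_Suc: "block_proper (Suc N) g \<longleftrightarrow> block_proper N g \<and> (\<forall>i. block_adj i N \<longrightarrow> g i \<noteq> g N)"
  unfolding block_proper_def by (auto simp: less_Suc_eq)

lemma block_proper_cong: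
  assumes "\<And>i. i < N \<Longrightarrow> g i = h i"
  shows "block_proper N g \<longleftrightarrow> block_proper N h"
proof -
  have "g i = h i \<and> g j = h j" if "block_adj i j" "j < N" for i j
    using that assms[of i] assms[of j] unfolding block_adj_def by auto
  then show ?thesis unfolding block_proper_def by auto
qed

text \<open>Only the last position of a block has a third earlier neighbor; the other positions see
  just their two predecessors. The wrap-around edges of a cycle are not part of
  \<open>block_adj\<close>.\<close>

lemma block_adj_block:
  "block_adj i (4 * b + 3) \<longleftrightarrow> i = 4 * b \<or> i = 4 * b + 1 \<or> i = 4 * b + 2"
  "block_adj i (4 * b + 4) \<longleftrightarrow> i = 4 * b + 2 \<or> i = 4 * b + 3"
  "block_adj i (4 * b + 5) \<longleftrightarrow> i = 4 * b + 3 \<or> i = 4 * b + 4"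
  "block_adj i (4 * b + 6) \<longleftrightarrow> i = 4 * b + 4 \<or> i = 4 * b + 5"
  "block_adj i (4 * b + 7) \<longleftrightarrow> i = 4 * b + 4 \<or> i = 4 * b + 5 \<or> i = 4 * b + 6"
proof -
  have "i div 4 = b \<longleftrightarrow> 4 * b \<le> i \<and> i < 4 * b + 4" by auto
  then show "block_adj i (4 * b + 3) \<longleftrightarrow> i = 4 * b \<or> i = 4 * b + 1 \<or> i = 4 * b + 2"
    unfolding block_adj_def by auto
  show "block_adj i (4 * b + 4) \<longleftrightarrow> i = 4 * b + 2 \<or> i = 4 * b + 3"
    unfolding block_adj_def by auto
  show "block_adj i (4 * b + 5) \<longleftrightarrow> i = 4 * b + 3 \<or> i = 4 * b + 4"
    unfolding block_adj_def by auto
  show "block_adj i (4 * b + 6) \<longleftrightarrow> i = 4 * b + 4 \<or> i = 4 * b + 5"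
    unfolding block_adj_def by auto
  show "block_adj i (4 * b + 7) \<longleftrightarrow> i = 4 * b + 4 \<or> i = 4 * b + 5 \<or> i = 4 * b + 6"
    unfolding block_adj_def by auto
qed

lemma block_proper_block:
  "block_proper (4 * b + 4) g \<longleftrightarrow> block_proper (4 * b + 3) g \<and>
    g (4 * b) \<noteq> g (4 * b + 3) \<and> g (4 * b + 1) \<noteq> g (4 * b + 3) \<and> g (4 * b + 2) \<noteq> g (4 * b + 3)"
  "block_proper (4 * b + 5) g \<longleftrightarrow> block_proper (4 * b + 4) g \<and>
    g (4 * b + 2) \<noteq> g (4 * b + 4) \<and> g (4 * b + 3) \<noteq> g (4 * b + 4)"
  "block_proper (4 * b + 6) g \<longleftrightarrow> block_proper (4 * b + 5) g \<and>
    g (4 * b + 3) \<noteq> g (4 * b + 5) \<and> g (4 * b + 4) \<noteq> g (4 * b + 5)"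
  "block_proper (4 * b + 7) g \<longleftrightarrow> block_proper (4 * b + 6) g \<and>
    g (4 * b + 4) \<noteq> g (4 * b + 6) \<and> g (4 * b + 5) \<noteq> g (4 * b + 6)"
  "block_proper (4 * b + 8) g \<longleftrightarrow> block_proper (4 * b + 7) g \<and>
    g (4 * b + 4) \<noteq> g (4 * b + 7) \<and> g (4 * b + 5) \<noteq> g (4 * b + 7) \<and> g (4 * b + 6) \<noteq> g (4 * b + 7)"
proof -
  have *: "4 * b + 4 = Suc (4 * b + 3)" "4 * b + 5 = Suc (4 * b + 4)" "4 * b + 6 = Suc (4 * b + 5)"
    "4 * b + 7 = Suc (4 * b + 6)" "4 * b + 8 = Suc (4 * b + 7)" by simp_all
  show "block_proper (4 * b + 4) g \<longleftrightarrow> block_proper (4 * b + 3) g \<and>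
      g (4 * b) \<noteq> g (4 * b + 3) \<and> g (4 * b + 1) \<noteq> g (4 * b + 3) \<and> g (4 * b + 2) \<noteq> g (4 * b + 3)"
    by (subst *(1)) (auto simp only: block_proper_Suc block_adj_block)
  show "block_proper (4 * b + 5) g \<longleftrightarrow> block_proper (4 * b + 4) g \<and>
      g (4 * b + 2) \<noteq> g (4 * b + 4) \<and> g (4 * b + 3) \<noteq> g (4 * b + 4)"
    by (subst *(2)) (auto simp only: block_proper_Suc block_adj_block)
  show "block_proper (4 * b + 6) g \<longleftrightarrow> block_proper (4 * b + 5) g \<and>
      g (4 * b + 3) \<noteq> g (4 * b + 5) \<and> g (4 * b + 4) \<noteq> g (4 * b + 5)"
    by (subst *(3)) (auto simp only: block_proper_Suc block_adj_block)
  show "block_proper (4 * b + 7) g \<longleftrightarrow> block_proper (4 * b + 6) g \<and>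
      g (4 * b + 4) \<noteq> g (4 * b + 6) \<and> g (4 * b + 5) \<noteq> g (4 * b + 6)"
    by (subst *(4)) (auto simp only: block_proper_Suc block_adj_block)
  show "block_proper (4 * b + 8) g \<longleftrightarrow> block_proper (4 * b + 7) g \<and>
      g (4 * b + 4) \<noteq> g (4 * b + 7) \<and> g (4 * b + 5) \<noteq> g (4 * b + 7) \<and> g (4 * b + 6) \<noteq> g (4 * b + 7)"
    by (subst *(5)) (auto simp only: block_proper_Suc block_adj_block)
qed

text \<open>The color \<open>c\<close> of the last position of a block is fixed in advance. Within
  that block the earlier positions must avoid \<open>c\<close>, but they have only two earlier
  neighbors, so three colors are forbidden at most.\<close>

lemma greedy_with_target:
  assumes "block_proper s g0" "s \<le> 4 * b + 3"
    and "\<And>j. s \<le> j \<Longrightarrow> j < 4 * b + 3 \<Longrightarrow> card (M j) = 4"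
    and "\<And>i. i < s \<Longrightarrow> 4 * b \<le> i \<Longrightarrow> g0 i \<noteq> c"
  shows "\<exists>g. (\<forall>i<s. g i = g0 i) \<and> (\<forall>j. s \<le> j \<longrightarrow> j < 4 * b + 3 \<longrightarrow> g j \<in> M j) \<and>
    g (4 * b + 3) = c \<and> block_proper (4 * b + 4) g"
proof -
  have "\<exists>g. (\<forall>i<s. g i = g0 i) \<and> (\<forall>j. s \<le> j \<longrightarrow> j < N \<longrightarrow> g j \<in> M j) \<and>
      (\<forall>i<N. 4 * b \<le> i \<longrightarrow> g i \<noteq> c) \<and> block_proper N g" if "N \<le> 4 * b + 3" "s \<le> N" for N
    using that(2,1)
  proof (induction N rule: dec_induct)
    case base
    show ?case using assms(1,4) by (intro exI[of _ g0]) simp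
  next
    case (step N)
    then obtain g where g: "\<forall>i<s. g i = g0 i" "\<forall>j. s \<le> j \<longrightarrow> j < N \<longrightarrow> g j \<in> M j"
      "\<forall>i<N. 4 * b \<le> i \<longrightarrow> g i \<noteq> c" "block_proper N g" by auto
    define B where "B = (if 4 * b \<le> N then {g (N - 1), g (N - 2), c} else {g (N - 1), g (N - 2), g (N - 3)})"
    have "finite B" unfolding B_def by simp
    moreover have "card B \<le> 3" unfolding B_def by (auto simp: card_insert_if)
    moreover have "card (M N) = 4" using assms(3) step by auto
    ultimately obtain x where x: "x \<in> M N" "x \<notin> B" using ex_not_in[of B "M N"] by auto
    have "g i \<in> B" if "block_adj i N" for i
    proof -
      have "i < N" "N \<le> i + 2 \<or> i div 4 = N div 4" using that unfolding block_adj_def by auto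
      moreover have "N < i + 4" if "i div 4 = N div 4" using that by linarith
      moreover have "N \<le> i + 2" if "i div 4 = N div 4" "4 * b \<le> N"
      proof -
        have "b \<le> i div 4" using div_le_mono[OF that(2), of 4] that(1) by simp
        then have "4 * b \<le> i" using div_times_less_eq_dividend[of i 4] by linarith
        then show ?thesis using step.prems by linarith
      qed
      ultimately have "i = N - 1 \<or> i = N - 2 \<or> i = N - 3" "4 * b \<le> N \<Longrightarrow> i = N - 1 \<or> i = N - 2"
        by linarith+
      then show ?thesis unfolding B_def by auto
    qed
    then have "g i \<noteq> x" if "block_adj i N" for i using x(2) that by blast
    moreover have "i \<noteq> N" if "block_adj i N" for i using that unfolding block_adj_def by simp
    ultimately have valid: "block_proper (Suc N) (g(N := x))"
      using g(4) block_proper_cong[of N "g(N := x)" g] by (auto simp: block_proper_Suc)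
    have "4 * b \<le> N \<Longrightarrow> x \<noteq> c" using x(2) unfolding B_def by auto
    moreover define h where "h = g(N := x)"
    ultimately have "\<forall>i<s. h i = g0 i" "\<forall>j. s \<le> j \<longrightarrow> j < Suc N \<longrightarrow> h j \<in> M j"
        "\<forall>i<Suc N. 4 * b \<le> i \<longrightarrow> h i \<noteq> c" "block_proper (Suc N) h"
      using g(1-3) x(1) step(1) valid by (auto simp: less_Suc_eq)
    then show ?case by blast
  qed
  from this[of "4 * b + 3"] assms(2) obtain g where g: "\<forall>i<s. g i = g0 i"
    "\<forall>j. s \<le> j \<longrightarrow> j < 4 * b + 3 \<longrightarrow> g j \<in> M j"
    "\<forall>i<4 * b + 3. 4 * b \<le> i \<longrightarrow> g i \<noteq> c" "block_proper (4 * b + 3) g" by auto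
  have "block_proper (4 * b + 4) (g(4 * b + 3 := c))"
    unfolding block_proper_block using g(3,4) block_proper_cong[of "4 * b + 3" "g(4 * b + 3 := c)" g] by auto
  moreover define h where "h = g(4 * b + 3 := c)"
  ultimately have "\<forall>i<s. h i = g0 i" "\<forall>j. s \<le> j \<longrightarrow> j < 4 * b + 3 \<longrightarrow> h j \<in> M j"
      "h (4 * b + 3) = c" "block_proper (4 * b + 4) h"
    using g(1,2) assms(2) by auto
  then show ?thesis by blast
qed

section \<open>Squares of long cycles\<close>

text \<open>Here \<open>4 * b + 3\<close> is the last end of a block that still leaves a vertex
  after it; one to four vertices remain.\<close>

lemma four_mult_cases:
  assumes "7 \<le> (N::nat)"
  obtains b where "N = 4 * b + 5" | b where "N = 4 * b + 6" | b where "N = 4 * b + 7" | b where "N = 4 * b + 8"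
proof -
  have "N = 4 * ((N - 5) div 4) + 5 + (N - 5) mod 4" using assms by simp
  moreover have "(N - 5) mod 4 < 4" by simp
  ultimately have "N = 4 * ((N - 5) div 4) + 5 \<or> N = 4 * ((N - 5) div 4) + 6 \<or>
      N = 4 * ((N - 5) div 4) + 7 \<or> N = 4 * ((N - 5) div 4) + 8" by linarith
  then show thesis using that by blast
qed

text \<open>
  The color \<open>c\<close> of the last greedily colored vertex, at position \<open>4 * b + 3\<close>, is chosen such that the
  lists of the remaining one to four vertices, reduced by the colors \<open>u\<close>, \<open>v\<close> of the first two
  vertices and by \<open>c\<close>, satisfy Hall's condition.
\<close>

lemma cycle_square_block_coloring_general:
  fixes d :: "nat \<Rightarrow> nat"
  assumes n: "7 \<le> n" "n = 7 \<Longrightarrow> p \<noteq> 1" and p: "p < 4" and d: "inj_on d {..<p}" and N: "N = p + n"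
    and M: "\<And>j. p \<le> j \<Longrightarrow> j < N \<Longrightarrow> card (M j) = 4"
  shows "\<exists>g. (\<forall>i<p. g i = d i) \<and> (\<forall>j. p \<le> j \<longrightarrow> j < N \<longrightarrow> g j \<in> M j) \<and> block_proper N g \<and>
    g (N - 1) \<noteq> g p \<and> g (N - 1) \<noteq> g (p + 1) \<and> g (N - 2) \<noteq> g p"
proof -
  have fM: "finite (M j)" if "p \<le> j" "j < N" for j
    using M[OF that] by (intro card_ge_0_finite) simp
  have cM: "k + card B \<le> 4 \<Longrightarrow> finite B \<Longrightarrow> k \<le> card (M j - B)" if "p \<le> j" "j < N" for j k B
    using M[OF that] by (intro card_Diff_ge) simp
  have c2: "card {x, y} \<le> 2" for x y :: nat by (simp add: card_insert_if)
  have c3: "card {x, y, z} \<le> 3" for x y z :: nat by (simp add: card_insert_if)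
  obtain g0 where g0: "\<forall>i<p. g0 i = d i" "\<forall>j. p \<le> j \<longrightarrow> j < p + 2 \<longrightarrow> g0 j \<in> M j"
    and g0d: "\<forall>i j. i < j \<longrightarrow> j < p + 2 \<longrightarrow> j < i + 4 \<longrightarrow> g0 i \<noteq> g0 j"
    using greedy_coloring[of p 4 d "p + 2" M] p d M n(1) N by auto
  have v0: "block_proper (p + 2) g0"
  proof -
    have "j < i + 4" if "block_adj i j" for i j
      using that unfolding block_adj_def by linarith
    then show ?thesis using g0d unfolding block_proper_def block_adj_def by blast
  qed
  define u v where "u = g0 p" and "v = g0 (p + 1)"
  \<comment> \<open>The first two vertices may lie in the same block as position
    \<open>4 * b + 3\<close>; the last condition on \<open>c\<close> keeps it away from their colors
    and from inherited colors in that block.\<close>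
  have ext: "\<exists>g. (\<forall>i<p. g i = d i) \<and> (\<forall>j. p \<le> j \<longrightarrow> j < 4 * b + 4 \<longrightarrow> g j \<in> M j) \<and>
      g p = u \<and> g (p + 1) = v \<and> g (4 * b + 3) = c \<and> block_proper (4 * b + 4) g"
    if b: "4 * b + 3 < N" "p + 2 \<le> 4 * b + 3" and c: "c \<in> M (4 * b + 3)"
      "\<And>i. i < p + 2 \<Longrightarrow> 4 * b \<le> i \<Longrightarrow> g0 i \<noteq> c" for b c
  proof -
    obtain g where g: "\<forall>i<p + 2. g i = g0 i" "\<forall>j. p + 2 \<le> j \<longrightarrow> j < 4 * b + 3 \<longrightarrow> g j \<in> M j"
      "g (4 * b + 3) = c" "block_proper (4 * b + 4) g"
      using greedy_with_target[OF v0 b(2), of M c] M c(2) b(1) by auto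
    have "g j \<in> M j" if j: "p \<le> j" "j < 4 * b + 4" for j
    proof -
      consider "j < p + 2" | "p + 2 \<le> j" "j < 4 * b + 3" | "j = 4 * b + 3" using j(2) by linarith
      then show ?thesis using g g0(2) c(1) j by cases auto
    qed
    then show ?thesis using g g0(1) unfolding u_def v_def by (intro exI[of _ g]) auto
  qed
  have "7 \<le> N" using n N by simp
  then show ?thesis
  proof (cases rule: four_mult_cases)
    case (1 b)
    have pb: "p + 2 \<le> 4 * b" using 1 N n by linarith
    \<comment> \<open>Here position \<open>4 * b + 3\<close> holds the last vertex but one, adjacent
      to the first, so \<open>c\<close> must avoid \<open>u\<close>. Two colors are kept for the
      last vertex because \<open>g (4 * b + 2)\<close>, not yet known, may remove one of
      them.\<close>
    have "2 < card (M (4 * b + 3) - {u})" using cM[of "4 * b + 3" 3 "{u}"] pb 1 by simp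
    moreover have "2 \<le> card (M (4 * b + 4) - {u, v})" using cM[of "4 * b + 4" 2 "{u, v}"] c2 pb 1 by simp
    ultimately obtain c where c: "c \<in> M (4 * b + 3) - {u}" "2 \<le> card (M (4 * b + 4) - {u, v} - {c})"
      using ex_card_Diff_ge[of 2 "M (4 * b + 3) - {u}" "M (4 * b + 4) - {u, v}"] fM[of "4 * b + 4"] pb 1
      by auto
    obtain g where g: "\<forall>i<p. g i = d i" "\<forall>j. p \<le> j \<longrightarrow> j < 4 * b + 4 \<longrightarrow> g j \<in> M j"
      "g p = u" "g (p + 1) = v" "g (4 * b + 3) = c" "block_proper (4 * b + 4) g"
      using ext[of b c] c(1) pb 1 by auto
    obtain z where z: "z \<in> M (4 * b + 4) - {u, v} - {c}" "z \<notin> {g (4 * b + 2)}"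
      using ex_not_in[of "{g (4 * b + 2)}" "M (4 * b + 4) - {u, v} - {c}"] c(2) by auto
    define h where "h = g(4 * b + 4 := z)"
    have hg: "h i = g i" if "i < 4 * b + 4" for i using that unfolding h_def by simp
    have hz: "h (4 * b + 4) = z" unfolding h_def by simp
    have "block_proper N h"
      unfolding 1 block_proper_block(2) using block_proper_cong[of "4 * b + 4" h g] g z hg hz by auto
    moreover have "h j \<in> M j" if "p \<le> j" "j < N" for j
      using that g(2) z hg hz 1 by (cases "j < 4 * b + 4") (auto dest: less_antisym)
    moreover have "N - 1 = 4 * b + 4" "N - 2 = 4 * b + 3" using 1 by simp_all
    ultimately show ?thesis
      using g z c hg hz pb by (intro exI[of _ h]) auto
  next
    case (2 b)
    have pb: "p + 1 \<le> 4 * b" using 2 N n by linarith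
    \<comment> \<open>No wrap-around edge reaches position \<open>4 * b + 3\<close>;
      \<open>v\<close> is avoided because the second vertex may open the block of \<open>c\<close>,
      namely when \<open>p + 1 = 4 * b\<close>. The last list keeps two colors to allow for
      \<open>y\<close>.\<close>
    have "2 < card (M (4 * b + 3) - {v})" using cM[of "4 * b + 3" 3 "{v}"] pb 2 by simp
    moreover have "2 \<le> card (M (4 * b + 5) - {u, v})" using cM[of "4 * b + 5" 2 "{u, v}"] c2 pb 2 by simp
    ultimately obtain c where c: "c \<in> M (4 * b + 3) - {v}" "2 \<le> card (M (4 * b + 5) - {u, v} - {c})"
      using ex_card_Diff_ge[of 2 "M (4 * b + 3) - {v}" "M (4 * b + 5) - {u, v}"] fM[of "4 * b + 5"] pb 2
      by auto
    have "g0 i \<noteq> c" if "i < p + 2" "4 * b \<le> i" for i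
    proof -
      have "i = p + 1" using that pb by linarith
      then show ?thesis using c(1) v_def by auto
    qed
    then obtain g where g: "\<forall>i<p. g i = d i" "\<forall>j. p \<le> j \<longrightarrow> j < 4 * b + 4 \<longrightarrow> g j \<in> M j"
      "g p = u" "g (p + 1) = v" "g (4 * b + 3) = c" "block_proper (4 * b + 4) g"
      using ext[of b c] c(1) pb 2 by auto
    have "card {u, c, g (4 * b + 2)} < card (M (4 * b + 4))"
      using M[of "4 * b + 4"] c3[of u c "g (4 * b + 2)"] pb 2 by simp
    then obtain y where y: "y \<in> M (4 * b + 4) - {u, c, g (4 * b + 2)}"
      using ex_not_in[of "{u, c, g (4 * b + 2)}" "M (4 * b + 4)"] by auto
    obtain z where z: "z \<in> M (4 * b + 5) - {u, v} - {c}" "z \<notin> {y}"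
      using ex_not_in[of "{y}" "M (4 * b + 5) - {u, v} - {c}"] c(2) by auto
    define h where "h = g(4 * b + 4 := y, 4 * b + 5 := z)"
    have hg: "h i = g i" if "i < 4 * b + 4" for i using that unfolding h_def by simp
    have hz: "h (4 * b + 4) = y" "h (4 * b + 5) = z" unfolding h_def by simp_all
    have "block_proper N h"
      unfolding 2 block_proper_block(2,3) using block_proper_cong[of "4 * b + 4" h g] g y z hg hz by auto
    moreover have "h j \<in> M j" if "p \<le> j" "j < N" for j
    proof -
      consider "j < 4 * b + 4" | "j = 4 * b + 4" | "j = 4 * b + 5" using \<open>j < N\<close> 2 by linarith
      then show ?thesis using that g(2) y z hg hz by cases auto
    qed
    moreover have "N - 1 = 4 * b + 5" "N - 2 = 4 * b + 4" using 2 by simp_all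
    ultimately show ?thesis
      using g y z c hg hz pb by (intro exI[of _ h]) auto
  next
    case (3 b)
    have pb: "p \<le> 4 * b" using 3 N n by linarith
    \<comment> \<open>Two candidates for \<open>c\<close> suffice to give the lists of the last two
      vertices three colors together, as \<open>ex_distinct_triple\<close> demands.\<close>
    have "2 \<le> card (M (4 * b + 3) - {u, v})" using cM[of "4 * b + 3" 2] c2 pb 3 by simp
    moreover have X: "2 < card (M (4 * b + 5) - {u})" using cM[of "4 * b + 5" 3 "{u}"] pb 3 by simp
    moreover have Y: "2 \<le> card (M (4 * b + 6) - {u, v})" using cM[of "4 * b + 6" 2] c2 pb 3 by simp
    ultimately obtain c where c: "c \<in> M (4 * b + 3) - {u, v}"
      "2 < card ((M (4 * b + 5) - {u} - {c}) \<union> (M (4 * b + 6) - {u, v}))"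
      using ex_card_Diff_Un_gr[of "M (4 * b + 3) - {u, v}" "M (4 * b + 5) - {u}" "M (4 * b + 6) - {u, v}" 2]
        fM[of "4 * b + 5"] fM[of "4 * b + 6"] pb 3
      by auto
    have "g0 i \<noteq> c" if "i < p + 2" "4 * b \<le> i" for i
    proof -
      have "i = p \<or> i = p + 1" using that pb by linarith
      then show ?thesis using c(1) u_def v_def by auto
    qed
    then obtain g where g: "\<forall>i<p. g i = d i" "\<forall>j. p \<le> j \<longrightarrow> j < 4 * b + 4 \<longrightarrow> g j \<in> M j"
      "g p = u" "g (p + 1) = v" "g (4 * b + 3) = c" "block_proper (4 * b + 4) g"
      using ext[of b c] c(1) pb p 3 by auto
    have "1 \<le> card (M (4 * b + 4) - {g (4 * b + 2), c})" using cM[of "4 * b + 4" 1] c2[of "g (4 * b + 2)" c] pb 3 by simp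
    moreover have "2 \<le> card (M (4 * b + 5) - {u} - {c})"
      using X card_Diff_ge[of 2 "{c}" "M (4 * b + 5) - {u}"] by simp
    ultimately obtain x y z where x: "x \<in> M (4 * b + 4) - {g (4 * b + 2), c}" and y: "y \<in> M (4 * b + 5) - {u} - {c}"
      and z: "z \<in> M (4 * b + 6) - {u, v}" and ne: "x \<noteq> y" "x \<noteq> z" "y \<noteq> z"
      using ex_distinct_triple[of "M (4 * b + 4) - {g (4 * b + 2), c}" "M (4 * b + 5) - {u} - {c}" "M (4 * b + 6) - {u, v}"] Y c(2)
      by auto
    define h where "h = g(4 * b + 4 := x, 4 * b + 5 := y, 4 * b + 6 := z)"
    have hg: "h i = g i" if "i < 4 * b + 4" for i using that unfolding h_def by simp
    have hz: "h (4 * b + 4) = x" "h (4 * b + 5) = y" "h (4 * b + 6) = z" unfolding h_def by simp_all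
    have "block_proper N h"
      unfolding 3 block_proper_block(2-4) using block_proper_cong[of "4 * b + 4" h g] g x y z ne hg hz by auto
    moreover have "h j \<in> M j" if "p \<le> j" "j < N" for j
    proof -
      consider "j < 4 * b + 4" | "j = 4 * b + 4" | "j = 4 * b + 5" | "j = 4 * b + 6" using \<open>j < N\<close> 3 by linarith
      then show ?thesis using that g(2) x y z hg hz by cases auto
    qed
    moreover have "N - 1 = 4 * b + 6" "N - 2 = 4 * b + 5" using 3 by simp_all
    ultimately show ?thesis
      using g y z c hg hz pb by (intro exI[of _ h]) auto
  next
    case (4 b)
    have pb: "p \<le> 4 * b"
    \<comment> \<open>For \<open>n = 7\<close>, \<open>p = 1\<close> the block of \<open>c\<close>
      would also contain \<open>d 0\<close>; avoiding \<open>d 0\<close>, \<open>u\<close> and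
      \<open>v\<close> might leave one candidate, while two are needed.\<close>
    proof (cases "n = 7")
      case True
      then have "p = 4 * b + 1" using 4 N by linarith
      moreover from this have "b = 0" using p by linarith
      ultimately show ?thesis using n(2) True by simp
    next
      case False
      then show ?thesis using 4 N n by linarith
    qed
    have "2 \<le> card (M (4 * b + 3) - {u, v})" using cM[of "4 * b + 3" 2] c2 pb 4 by simp
    moreover have X: "3 < card (M (4 * b + 5))" using M[of "4 * b + 5"] pb 4 by simp
    \<comment> \<open>The two middle vertices of the final block carry the lists of size 3 whose
      union must have four colors: the first sees \<open>c\<close>, the second sees
      \<open>u\<close>.\<close>
    moreover have Y: "3 \<le> card (M (4 * b + 6) - {u})" using cM[of "4 * b + 6" 3] pb 4 by simp
    ultimately obtain c where c: "c \<in> M (4 * b + 3) - {u, v}"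
      "3 < card ((M (4 * b + 5) - {c}) \<union> (M (4 * b + 6) - {u}))"
      using ex_card_Diff_Un_gr[of "M (4 * b + 3) - {u, v}" "M (4 * b + 5)" "M (4 * b + 6) - {u}" 3]
        fM[of "4 * b + 5"] fM[of "4 * b + 6"] pb 4
      by auto
    have "g0 i \<noteq> c" if "i < p + 2" "4 * b \<le> i" for i
    proof -
      have "i = p \<or> i = p + 1" using that pb by linarith
      then show ?thesis using c(1) u_def v_def by auto
    qed
    then obtain g where g: "\<forall>i<p. g i = d i" "\<forall>j. p \<le> j \<longrightarrow> j < 4 * b + 4 \<longrightarrow> g j \<in> M j"
      "g p = u" "g (p + 1) = v" "g (4 * b + 3) = c" "block_proper (4 * b + 4) g"
      using ext[of b c] c(1) pb p 4 by auto
    have "1 \<le> card (M (4 * b + 7) - {u, v})" using cM[of "4 * b + 7" 1] c2[of u v] pb 4 by simp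
    moreover have "2 \<le> card (M (4 * b + 4) - {g (4 * b + 2), c})"
      using cM[of "4 * b + 4" 2] c2 pb 4 by simp
    moreover have "3 \<le> card (M (4 * b + 5) - {c})" using X by (intro card_Diff_ge) auto
    ultimately obtain w x y z where w: "w \<in> M (4 * b + 4) - {g (4 * b + 2), c}"
      and x: "x \<in> M (4 * b + 5) - {c}" and y: "y \<in> M (4 * b + 6) - {u}" and z: "z \<in> M (4 * b + 7) - {u, v}"
      and ne: "w \<noteq> x" "w \<noteq> y" "w \<noteq> z" "x \<noteq> y" "x \<noteq> z" "y \<noteq> z"
      using ex_distinct_quadruple[of "M (4 * b + 7) - {u, v}" "M (4 * b + 4) - {g (4 * b + 2), c}" "M (4 * b + 5) - {c}"
          "M (4 * b + 6) - {u}"] Y c(2)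
      by auto
    define h where "h = g(4 * b + 4 := w, 4 * b + 5 := x, 4 * b + 6 := y, 4 * b + 7 := z)"
    have hg: "h i = g i" if "i < 4 * b + 4" for i using that unfolding h_def by simp
    have hz: "h (4 * b + 4) = w" "h (4 * b + 5) = x" "h (4 * b + 6) = y" "h (4 * b + 7) = z"
      unfolding h_def by simp_all
    have "block_proper N h"
      unfolding 4 block_proper_block(2-5) using block_proper_cong[of "4 * b + 4" h g] g w x y z ne hg hz by auto
    moreover have "h j \<in> M j" if "p \<le> j" "j < N" for j
    proof -
      consider "j < 4 * b + 4" | "j = 4 * b + 4" | "j = 4 * b + 5" | "j = 4 * b + 6" | "j = 4 * b + 7"
        using \<open>j < N\<close> 4 by linarith
      then show ?thesis using that g(2) w x y z hg hz by cases auto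
    qed
    moreover have "N - 1 = 4 * b + 7" "N - 2 = 4 * b + 6" using 4 by simp_all
    ultimately show ?thesis
      using g y z c hg hz pb by (intro exI[of _ h]) auto
  qed
qed

section \<open>Squares of cycles of length 6 and 7\<close>

lemma block_proper_3: "block_proper 3 g \<longleftrightarrow> g 0 \<noteq> g 1 \<and> g 0 \<noteq> g 2 \<and> g 1 \<noteq> g 2"
proof -
  have "block_adj i j \<and> j < 3 \<longleftrightarrow> (i, j) \<in> {(0, 1), (0, 2), (1, 2)}" for i j
    unfolding block_adj_def by auto
  then have "block_proper 3 g \<longleftrightarrow> (\<forall>i j. (i, j) \<in> {(0, 1), (0, 2), (1, 2)} \<longrightarrow> g i \<noteq> g j)"
    unfolding block_proper_def by metis
  also have "\<dots> \<longleftrightarrow> g 0 \<noteq> g 1 \<and> g 0 \<noteq> g 2 \<and> g 1 \<noteq> g 2" by blast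
  finally show ?thesis .
qed

lemmas block_proper_numeral =
  block_proper_block[of 0, simplified] block_proper_block[of 1, simplified] block_proper_3 

text \<open>In the square of a hexagon each vertex misses only the opposite one, so
  \<open>c3\<close> need not avoid \<open>c0\<close>, nor \<open>c4\<close> avoid \<open>c1\<close>.
  The other four colors form a block and are all distinct, including the opposite pair
  \<open>c2\<close>, \<open>c5\<close>. The last assumption is the union bound of
  \<open>ex_distinct_quadruple\<close>.\<close>

lemma hexagon_completion:
  assumes "card L2 = 4" "card L3 = 4" "card L4 = 4" "3 \<le> card L5"
    and "3 < card ((L3 - {c1}) \<union> (L4 - {c0}))"
  shows "\<exists>c2\<in>L2. \<exists>c3\<in>L3. \<exists>c4\<in>L4. \<exists>c5\<in>L5. distinct [c2, c3, c4, c5] \<and>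
    c2 \<noteq> c0 \<and> c2 \<noteq> c1 \<and> c3 \<noteq> c1 \<and> c4 \<noteq> c0 \<and> c5 \<noteq> c0 \<and> c5 \<noteq> c1"
proof -
  have c2: "card {c0, c1} \<le> 2" by (simp add: card_insert_if)
  have "2 \<le> card (L2 - {c0, c1})" "1 \<le> card (L5 - {c0, c1})" "3 \<le> card (L3 - {c1})" "3 \<le> card (L4 - {c0})"
    using assms c2 by (auto intro!: card_Diff_ge)
  then obtain c2 c3 c4 c5 where "c2 \<in> L2 - {c0, c1}" "c5 \<in> L5 - {c0, c1}" "c3 \<in> L3 - {c1}" "c4 \<in> L4 - {c0}"
    and "c5 \<noteq> c2" "c5 \<noteq> c3" "c5 \<noteq> c4" "c2 \<noteq> c3" "c2 \<noteq> c4" "c3 \<noteq> c4"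
    using ex_distinct_quadruple[of "L5 - {c0, c1}" "L2 - {c0, c1}" "L3 - {c1}" "L4 - {c0}"] assms(5) by auto
  then show ?thesis
    by (intro bexI[of _ c2] bexI[of _ c3] bexI[of _ c4] bexI[of _ c5]) auto
qed

text \<open>If fixing some \<open>x\<close> in \<open>S\<close> leaves two candidates in
  \<open>T\<close>, \<open>ex_card_Diff_Un_gr\<close> applies. Otherwise two elements
  \<open>a\<close>, \<open>b\<close> of \<open>S\<close> also lie in \<open>T\<close>, and both
  orders are available. If both failed, then \<open>X - {b} = Y - {a}\<close> would give
  \<open>a\<close> outside \<open>X\<close>, so deleting \<open>a\<close> costs \<open>X\<close>
  nothing.\<close>

lemma ex_pair_card_Diff_Un_gr:
  assumes S: "2 \<le> card S" "2 \<le> card T" and XY: "card X = 4" "card Y = 4"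
  shows "\<exists>a\<in>S. \<exists>b\<in>T. a \<noteq> b \<and> 3 < card ((X - {b}) \<union> (Y - {a}))"
proof -
  have fin: "finite X" "finite Y" using XY by (auto intro: card_ge_0_finite)
  obtain a where a: "a \<in> S" using S(1) by fastforce
  obtain b where b: "b \<in> S" "a \<noteq> b" using ex_not_in[of "{a}" S] S(1) by auto
  have Y: "3 \<le> card (Y - {x})" "3 \<le> card (X - {x})" for x using XY by (auto intro!: card_Diff_ge)
  have *: ?thesis if x: "x \<in> S" "2 \<le> card (T - {x})" for x
  proof -
    obtain y where "y \<in> T - {x}" "3 < card ((X - {y}) \<union> (Y - {x}))"
      using ex_card_Diff_Un_gr[OF x(2) fin(1), of "Y - {x}" 3] fin(2) Y(1)[of x] XY(1) by auto
    then show ?thesis using x(1) by (intro bexI[of _ x] bexI[of _ y]) auto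
  qed
  show ?thesis
  proof (cases "2 \<le> card (T - {a}) \<or> 2 \<le> card (T - {b})")
    case True
    then show ?thesis using * a b(1) by blast
  next
    case False
    then have ab: "a \<in> T" "b \<in> T" using S(2) by force+
    have "3 < card ((X - {b}) \<union> (Y - {a})) \<or> 3 < card ((X - {a}) \<union> (Y - {b}))"
    proof (rule ccontr)
      assume n: "\<not> ?thesis"
      have eq: "X - {x} = Y - {y}" if "\<not> 3 < card ((X - {x}) \<union> (Y - {y}))" for x y
      proof -
        have f: "finite ((X - {x}) \<union> (Y - {y}))" using fin by simp
        have "X - {x} = (X - {x}) \<union> (Y - {y})" "Y - {y} = (X - {x}) \<union> (Y - {y})"
          using that Y(2)[of x] Y(1)[of y] by (intro card_seteq[OF f]; auto)+
        then show ?thesis by simp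
      qed
      have e: "X - {b} = Y - {a}" "X - {a} = Y - {b}" using eq n by blast+
      have "a \<notin> X" using e(1) b(2) by blast
      then have "card ((X - {a}) \<union> (Y - {b})) \<ge> 4" 
        using XY fin card_mono[of "(X - {a}) \<union> (Y - {b})" X] by auto
      then show False using n by simp
    qed
    then show ?thesis using a b ab by metis
  qed
qed

text \<open>The blocks are \<open>d0, a0, a1, a2\<close> and \<open>a3, a4, a5, a6\<close>, the
  first colored out of order. With \<open>a2\<close> chosen, \<open>a0\<close> has two candidates,
  enough to give the lists of \<open>a4\<close> and \<open>a5\<close> four colors together. The
  vertex of \<open>a1\<close> is adjacent to neither of these two, so \<open>a1\<close> can
  wait.\<close>

lemma heptagon_square_block_coloring:
  fixes d0 :: nat
  assumes M: "\<And>j. 1 \<le> j \<Longrightarrow> j < 8 \<Longrightarrow> card (M j) = 4"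
  shows "\<exists>g. g 0 = d0 \<and> (\<forall>j. 1 \<le> j \<longrightarrow> j < 8 \<longrightarrow> g j \<in> M j) \<and> block_proper 8 g \<and>
    g 7 \<noteq> g 1 \<and> g 7 \<noteq> g 2 \<and> g 6 \<noteq> g 1"
proof -
  have c2: "card {x, y} \<le> 2" for x y :: nat by (simp add: card_insert_if)
  have c3: "card {x, y, z} \<le> 3" for x y z :: nat by (simp add: card_insert_if)
  have m: "card (M 1) = 4" "card (M 2) = 4" "card (M 3) = 4" "card (M 4) = 4" "card (M 5) = 4"
    "card (M 6) = 4" "card (M 7) = 4" using M by simp_all
  have fin: "finite (M 5)" "finite (M 6)" using m by (auto intro: card_ge_0_finite)
  obtain a2 where a2: "a2 \<in> M 3" "a2 \<noteq> d0" using ex_not_in[of "{d0}" "M 3"] m by auto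
  have "2 \<le> card (M 1 - {d0, a2})" using m c2 by (auto intro!: card_Diff_ge)
  moreover have "3 \<le> card (M 5 - {a2})" using m by (auto intro!: card_Diff_ge)
  ultimately obtain a0 where a0: "a0 \<in> M 1 - {d0, a2}" "3 < card ((M 6 - {a0}) \<union> (M 5 - {a2}))"
    using ex_card_Diff_Un_gr[of "M 1 - {d0, a2}" "M 6" "M 5 - {a2}" 3] fin m by auto
  obtain a1 where a1: "a1 \<in> M 2" "a1 \<notin> {d0, a0, a2}"
    using ex_not_in[of "{d0, a0, a2}" "M 2"] c3[of d0 a0 a2] m by auto
  have "2 \<le> card (M 4 - {a1, a2})" "2 \<le> card (M 7 - {a0, a1})" "3 \<le> card (M 6 - {a0})" "3 \<le> card (M 5 - {a2})"
    using m c2 by (auto intro!: card_Diff_ge)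
  then obtain a3 a6 a5 a4 where a: "a3 \<in> M 4 - {a1, a2}" "a6 \<in> M 7 - {a0, a1}" "a5 \<in> M 6 - {a0}" "a4 \<in> M 5 - {a2}"
    "a3 \<noteq> a6" "a3 \<noteq> a5" "a3 \<noteq> a4" "a6 \<noteq> a5" "a6 \<noteq> a4" "a5 \<noteq> a4"
    using ex_distinct_quadruple[of "M 4 - {a1, a2}" "M 7 - {a0, a1}" "M 6 - {a0}" "M 5 - {a2}"] a0(2) by auto
  define g where "g = (!) [d0, a0, a1, a2, a3, a4, a5, a6]"
  have "block_proper 8 g"
    unfolding block_proper_numeral g_def using a0 a1 a2 a by auto
  moreover have "g j \<in> M j" if "1 \<le> j" "j < 8" for j
  proof -
    have "j = 1 \<or> j = 2 \<or> j = 3 \<or> j = 4 \<or> j = 5 \<or> j = 6 \<or> j = 7" using that by linarith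
    then show ?thesis unfolding g_def using a0 a1 a2 a by auto
  qed
  moreover have "g 0 = d0" "g 7 \<noteq> g 1" "g 7 \<noteq> g 2" "g 6 \<noteq> g 1" unfolding g_def using a by auto
  ultimately show ?thesis by blast
qed

lemma hexagon_square_block_coloring:
  fixes d :: "nat \<Rightarrow> nat"
  assumes p: "p < 4" and d: "inj_on d {..<p}" and N: "N = p + 6"
    and M: "\<And>j. p \<le> j \<Longrightarrow> j < N \<Longrightarrow> card (M j) = 4"
  shows "\<exists>g. (\<forall>i<p. g i = d i) \<and> (\<forall>j. p \<le> j \<longrightarrow> j < N \<longrightarrow> g j \<in> M j) \<and> block_proper N g \<and>
    g (N - 1) \<noteq> g p \<and> g (N - 1) \<noteq> g (p + 1) \<and> g (N - 2) \<noteq> g p"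
proof -
  have d2: "card {x, y} \<le> 2" for x y :: nat by (simp add: card_insert_if)
  have d3: "card {x, y, z} \<le> 3" for x y z :: nat by (simp add: card_insert_if)
  consider "p = 0" | "p = 1" | "p = 2" | "p = 3" using p by linarith
  then show ?thesis
  proof cases
    case 1
    have m: "card (M 0) = 4" "card (M 1) = 4" "card (M 2) = 4" "card (M 3) = 4" "card (M 4) = 4" "card (M 5) = 4"
      using M N 1 by simp_all
    obtain c0 c1 where c: "c0 \<in> M 4" "c1 \<in> M 5" "c0 \<noteq> c1" "3 < card ((M 1 - {c1}) \<union> (M 2 - {c0}))"
      using ex_pair_card_Diff_Un_gr[of "M 4" "M 5" "M 1" "M 2"] m by auto
    have le: "3 \<le> card (M 3)" using m by simp
    obtain c2 c3 c4 c5 where e: "c2 \<in> M 0" "c3 \<in> M 1" "c4 \<in> M 2" "c5 \<in> M 3" "distinct [c2, c3, c4, c5]"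
      "c2 \<noteq> c0" "c2 \<noteq> c1" "c3 \<noteq> c1" "c4 \<noteq> c0" "c5 \<noteq> c0" "c5 \<noteq> c1"
      using hexagon_completion[OF m(1-3) le c(4)] by blast
    \<comment> \<open>The hexagon is rotated: the full block comes first, and the pair
      \<open>c0\<close>, \<open>c1\<close> chosen beforehand occupies the incomplete block.\<close>
    define g where "g = (!) [c2, c3, c4, c5, c0, c1]"
    have "block_proper 6 g" unfolding block_proper_numeral g_def using c e by auto
    moreover have "g j \<in> M j" if "j < 6" for j
    proof -
      have "j = 0 \<or> j = 1 \<or> j = 2 \<or> j = 3 \<or> j = 4 \<or> j = 5" using that by linarith
      then show ?thesis unfolding g_def using c e by auto
    qed
    moreover have "g 5 \<noteq> g 0" "g 5 \<noteq> g 1" "g 4 \<noteq> g 0" unfolding g_def using c e by auto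
    ultimately show ?thesis using 1 N by (intro exI[of _ g]) auto
  next
    case 2
    \<comment> \<open>The blocks are \<open>d 0\<close> with three vertices, and the other three.
      Each triple is a triangle in the square, so once \<open>d 0\<close> is removed from the lists
      any proper coloring makes both blocks rainbow.\<close>
    have "\<exists>T\<subseteq>M (i + 1) - {d 0}. card T = 3" if "i < 6" for i
    proof -
      have "card (M (i + 1)) = 4" using M N 2 that by simp
      then have "3 \<le> card (M (i + 1) - {d 0})" by (intro card_Diff_ge) auto
      then show ?thesis by (metis obtain_subset_with_card_n)
    qed
    then obtain L where L: "\<And>i. i < 6 \<Longrightarrow> L i \<subseteq> M (i + 1) - {d 0} \<and> card (L i) = 3" by metis
    then obtain f where f: "\<forall>i<6. f i \<in> L i \<and> f i \<noteq> f ((i + 1) mod 6) \<and> f i \<noteq> f ((i + 2) mod 6)"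
      using cycle_square_3_choosable[of 6 L] by auto
    define g where "g = (!) [d 0, f 0, f 1, f 2, f 3, f 4, f 5]"
    have fi: "f i \<in> M (i + 1) \<and> f i \<noteq> d 0 \<and> f i \<noteq> f ((i + 1) mod 6) \<and> f i \<noteq> f ((i + 2) mod 6)" if "i < 6" for i
      using f L that by blast
    note f' = fi[of 0, simplified] fi[of 1, simplified] fi[of 2, simplified] fi[of 3, simplified]
      fi[of 4, simplified] fi[of 5, simplified]
    have "block_proper 7 g" unfolding block_proper_numeral g_def using f' by (auto simp: numeral_2_eq_2)
    moreover have "g j \<in> M j" if "1 \<le> j" "j < 7" for j
    proof -
      have "j = 1 \<or> j = 2 \<or> j = 3 \<or> j = 4 \<or> j = 5 \<or> j = 6" using that by linarith
      then show ?thesis unfolding g_def using f' by (auto simp: numeral_2_eq_2)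
    qed
    moreover have "g 6 \<noteq> g 1" "g 6 \<noteq> g 2" "g 5 \<noteq> g 1" "g 0 = d 0" unfolding g_def using f' by auto
    ultimately show ?thesis using 2 N by (intro exI[of _ g]) (auto simp: numeral_2_eq_2)
  next
    case 3
    have m: "card (M 2) = 4" "card (M 3) = 4" "card (M 4) = 4" "card (M 5) = 4" "card (M 6) = 4" "card (M 7) = 4"
      using M N 3 by simp_all
    have "d 0 \<noteq> d 1" using inj_onD[OF d, of 0 1] 3 by auto
    \<comment> \<open>The first two vertices share their block with both inherited colors; two
      candidates each are just what \<open>ex_pair_card_Diff_Un_gr\<close> requires.\<close>
    have "2 \<le> card (M 2 - {d 0, d 1})" "2 \<le> card (M 3 - {d 0, d 1})" using m d2 by (auto intro!: card_Diff_ge)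
    then obtain c0 c1 where c: "c0 \<in> M 2 - {d 0, d 1}" "c1 \<in> M 3 - {d 0, d 1}" "c0 \<noteq> c1"
      "3 < card ((M 5 - {c1}) \<union> (M 6 - {c0}))"
      using ex_pair_card_Diff_Un_gr[of "M 2 - {d 0, d 1}" "M 3 - {d 0, d 1}" "M 5" "M 6"] m by blast
    have le: "3 \<le> card (M 7)" using m by simp
    obtain c2 c3 c4 c5 where e: "c2 \<in> M 4" "c3 \<in> M 5" "c4 \<in> M 6" "c5 \<in> M 7" "distinct [c2, c3, c4, c5]"
      "c2 \<noteq> c0" "c2 \<noteq> c1" "c3 \<noteq> c1" "c4 \<noteq> c0" "c5 \<noteq> c0" "c5 \<noteq> c1"
      using hexagon_completion[OF m(3-5) le c(4)] by blast
    define g where "g = (!) [d 0, d 1, c0, c1, c2, c3, c4, c5]"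
    have "block_proper 8 g" unfolding block_proper_numeral g_def using \<open>d 0 \<noteq> d 1\<close> c e by auto
    moreover have "g j \<in> M j" if "2 \<le> j" "j < 8" for j
    proof -
      have "j = 2 \<or> j = 3 \<or> j = 4 \<or> j = 5 \<or> j = 6 \<or> j = 7" using that by linarith
      then show ?thesis unfolding g_def using c e by auto
    qed
    moreover have "g i = d i" if "i < 2" for i
      using that unfolding g_def by (auto simp: less_2_cases_iff)
    moreover have "g 7 \<noteq> g 2" "g 7 \<noteq> g 3" "g 6 \<noteq> g 2" unfolding g_def using c e by auto
    ultimately show ?thesis using 3 N by (intro exI[of _ g]) auto
  next
    case 4
    have m: "card (M 7) = 4" "card (M 6) = 4" "card (M 5) = 4" "card (M 4) = 4" "card (M 3) = 4" "card (M 8) = 4"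
      using M N 4 by simp_all
    have fin: "finite (M 6)" "finite (M 5)" using m by (auto intro: card_ge_0_finite)
    have dd: "d 0 \<noteq> d 1" "d 0 \<noteq> d 2" "d 1 \<noteq> d 2" using inj_onD[OF d, of 0 1] inj_onD[OF d, of 0 2] inj_onD[OF d, of 1 2] 4 by auto
    obtain c0 where c0: "c0 \<in> M 3" "c0 \<notin> {d 0, d 1, d 2}"
      using ex_not_in[of "{d 0, d 1, d 2}" "M 3"] d3[of "d 0" "d 1" "d 2"] m by auto
    have "2 \<le> card (M 8 - {c0})" "3 \<le> card (M 5 - {c0})" using m by (auto intro!: card_Diff_ge)
    then obtain c1 where c1: "c1 \<in> M 8 - {c0}" "3 < card ((M 6 - {c1}) \<union> (M 5 - {c0}))"
      using ex_card_Diff_Un_gr[of "M 8 - {c0}" "M 6" "M 5 - {c0}" 3] fin m by auto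
    \<comment> \<open>\<open>block_proper\<close> also separates positions 2 and 4, although
      \<open>d 2\<close> is an inherited color; this is where a list of size 3 for \<open>c5\<close>
      comes from.\<close>
    have le: "3 \<le> card (M 4 - {d 2})" using m by (intro card_Diff_ge) auto
    obtain c2 c3 c4 c5 where e: "c2 \<in> M 7" "c3 \<in> M 6" "c4 \<in> M 5" "c5 \<in> M 4 - {d 2}" "distinct [c2, c3, c4, c5]"
      "c2 \<noteq> c0" "c2 \<noteq> c1" "c3 \<noteq> c1" "c4 \<noteq> c0" "c5 \<noteq> c0" "c5 \<noteq> c1"
      using hexagon_completion[OF m(1-3) le c1(2)] by blast
    \<comment> \<open>The hexagon is traversed backwards from \<open>c0\<close>, so that
      \<open>c2\<close> to \<open>c5\<close> fill the middle block and \<open>c1\<close> stands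
      alone in the last one.\<close>
    define g where "g = (!) [d 0, d 1, d 2, c0, c5, c4, c3, c2, c1]"
    have "block_proper 9 g" unfolding block_proper_numeral g_def using dd c0 c1 e by (auto simp: numeral_2_eq_2)
    moreover have "g j \<in> M j" if "3 \<le> j" "j < 9" for j
    proof -
      have "j = 3 \<or> j = 4 \<or> j = 5 \<or> j = 6 \<or> j = 7 \<or> j = 8" using that by linarith
      then show ?thesis unfolding g_def using c0 c1 e by auto
    qed
    moreover have "g i = d i" if "i < 3" for i
    proof -
      have "i = 0 \<or> i = 1 \<or> i = 2" using that by linarith
      then show ?thesis unfolding g_def by auto
    qed
    moreover have "g 8 \<noteq> g 3" "g 8 \<noteq> g 4" "g 7 \<noteq> g 3" unfolding g_def using c0 c1 e by auto
    ultimately show ?thesis using 4 N by (intro exI[of _ g]) auto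
  qed
qed

section \<open>Extendable graphs\<close>

text \<open>
  \<open>F\<close> and \<open>F'\<close> are the colors of the incomplete block before and after coloring \<open>V\<close>; \<open>p\<close> and
  \<open>(card V + p) mod k\<close> bound its size, and \<open>(card V + p) div k\<close> blocks are completed on the way.
\<close>

definition extendable :: "nat \<Rightarrow> 'a set \<Rightarrow> ('a \<times> 'a) set \<Rightarrow> bool" where
  "extendable k V E \<longleftrightarrow> (\<forall>(L :: 'a \<Rightarrow> nat set) p F.
     (\<forall>v\<in>V. card (L v) = k) \<longrightarrow> p < k \<longrightarrow> finite F \<longrightarrow> card F \<le> p \<longrightarrow>
     (\<exists>f F'. (\<forall>v\<in>V. f v \<in> L v) \<and> (\<forall>u\<in>V. \<forall>v\<in>V. (u, v) \<in> E \<longrightarrow> f u \<noteq> f v) \<and>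
        finite F' \<and> card F' \<le> (card V + p) mod k \<and>
        (\<forall>c. card {v \<in> V. f v = c} + of_bool (c \<in> F) \<le> (card V + p) div k + of_bool (c \<in> F'))))"

lemma extendableI:
  assumes "\<And>(L :: 'a \<Rightarrow> nat set) p F. \<forall>v\<in>V. card (L v) = k \<Longrightarrow> p < k \<Longrightarrow> finite F \<Longrightarrow> card F \<le> p \<Longrightarrow>
     \<exists>f F'. (\<forall>v\<in>V. f v \<in> L v) \<and> (\<forall>u\<in>V. \<forall>v\<in>V. (u, v) \<in> E \<longrightarrow> f u \<noteq> f v) \<and>
        finite F' \<and> card F' \<le> (card V + p) mod k \<and>
        (\<forall>c. card {v \<in> V. f v = c} + of_bool (c \<in> F) \<le> (card V + p) div k + of_bool (c \<in> F'))"
  shows "extendable k V E"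
  using assms unfolding extendable_def by blast

lemma extendableE:
  fixes L :: "'a \<Rightarrow> nat set"
  assumes "extendable k V E" "\<forall>v\<in>V. card (L v) = k" "p < k" "finite F" "card F \<le> p"
  obtains f F' where "\<forall>v\<in>V. f v \<in> L v" "\<forall>u\<in>V. \<forall>v\<in>V. (u, v) \<in> E \<longrightarrow> f u \<noteq> f v"
    "finite F'" "card F' \<le> (card V + p) mod k"
    "\<forall>c. card {v \<in> V. f v = c} + of_bool (c \<in> F) \<le> (card V + p) div k + of_bool (c \<in> F')"
proof -
  have *: "\<And>p F. p < k \<Longrightarrow> finite F \<Longrightarrow> card F \<le> p \<Longrightarrow>
     \<exists>f F'. (\<forall>v\<in>V. f v \<in> L v) \<and> (\<forall>u\<in>V. \<forall>v\<in>V. (u, v) \<in> E \<longrightarrow> f u \<noteq> f v) \<and>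
        finite F' \<and> card F' \<le> (card V + p) mod k \<and>
        (\<forall>c. card {v \<in> V. f v = c} + of_bool (c \<in> F) \<le> (card V + p) div k + of_bool (c \<in> F'))"
    using spec[OF assms(1)[unfolded extendable_def], of L] assms(2) by simp
  show thesis using *[OF assms(3-5)] that by blast
qed

lemma extendable_empty: "extendable k {} E"
proof (rule extendableI)
  fix L :: "'a \<Rightarrow> nat set" and p :: nat and F :: "nat set"
  assume "p < k" "finite (F :: nat set)" "card F \<le> p"
  then show "\<exists>f F'. (\<forall>v\<in>{}. f v \<in> L v) \<and> (\<forall>u\<in>{}. \<forall>v\<in>{}. (u, v) \<in> E \<longrightarrow> f u \<noteq> f v) \<and>
        finite F' \<and> card F' \<le> (card {} + p) mod k \<and>
        (\<forall>c. card {v \<in> {}. f v = c} + of_bool (c \<in> F) \<le> (card {} + p) div k + of_bool (c \<in> F'))"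
    by (intro exI[of _ "\<lambda>_. 0"] exI[of _ F]) auto
qed

text \<open>The incomplete block left by \<open>V\<close> is the one inherited by \<open>W\<close>;
  quotients add up and remainders carry over. The assumption on \<open>E\<close> excludes edges
  between the two parts.\<close>

lemma extendable_Un:
  assumes V: "extendable k V E" and W: "extendable k W E" and fin: "finite V" "finite W"
    and disj: "V \<inter> W = {}" and E: "\<And>u v. (u, v) \<in> E \<Longrightarrow> u \<in> V \<longleftrightarrow> v \<in> V"
  shows "extendable k (V \<union> W) E"
proof (rule extendableI)
  fix L :: "'a \<Rightarrow> nat set" and p :: nat and F :: "nat set"
  assume L: "\<forall>v\<in>V \<union> W. card (L v) = k" and p: "p < k" and F: "finite F" "card F \<le> p"
  have LV: "\<forall>v\<in>V. card (L v) = k" and LW: "\<forall>v\<in>W. card (L v) = k" using L by auto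
  obtain f F1 where f: "\<forall>v\<in>V. f v \<in> L v" "\<forall>u\<in>V. \<forall>v\<in>V. (u, v) \<in> E \<longrightarrow> f u \<noteq> f v"
    and F1: "finite F1" "card F1 \<le> (card V + p) mod k"
    and cf: "\<forall>c. card {v \<in> V. f v = c} + of_bool (c \<in> F) \<le> (card V + p) div k + of_bool (c \<in> F1)"
    by (rule extendableE[OF V LV p F])
  have p': "(card V + p) mod k < k" using p by (intro mod_less_divisor) simp
  obtain g F2 where g: "\<forall>v\<in>W. g v \<in> L v" "\<forall>u\<in>W. \<forall>v\<in>W. (u, v) \<in> E \<longrightarrow> g u \<noteq> g v"
    and F2: "finite F2" "card F2 \<le> (card W + (card V + p) mod k) mod k"
    and cg: "\<forall>c. card {v \<in> W. g v = c} + of_bool (c \<in> F1) \<le>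
      (card W + (card V + p) mod k) div k + of_bool (c \<in> F2)"
    by (rule extendableE[OF W LW p' F1])
  have cVW: "card (V \<union> W) = card V + card W" using fin disj by (rule card_Un_disjoint)
  define h where "h v = (if v \<in> V then f v else g v)" for v
  have "(card W + (card V + p) mod k) mod k = (card (V \<union> W) + p) mod k"
    unfolding cVW by (simp add: mod_simps ac_simps)
  moreover have "card {v \<in> V \<union> W. h v = c} + of_bool (c \<in> F) \<le> (card (V \<union> W) + p) div k + of_bool (c \<in> F2)" for c
  proof -
    have "{v \<in> V \<union> W. h v = c} = {v \<in> V. f v = c} \<union> {v \<in> W. g v = c}"
      using disj unfolding h_def by auto
    then have "card {v \<in> V \<union> W. h v = c} = card {v \<in> V. f v = c} + card {v \<in> W. g v = c}"
      using fin disj by (subst card_Un_disjoint[symmetric]) auto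
    moreover have "(card W + (card V + p) mod k) div k + (card V + p) div k = (card (V \<union> W) + p) div k"
    proof -
      have "card (V \<union> W) + p = (card W + (card V + p) mod k) + (card V + p) div k * k"
        unfolding cVW by simp
      moreover have "(card W + (card V + p) mod k + (card V + p) div k * k) div k =
          (card V + p) div k + (card W + (card V + p) mod k) div k"
        using p by (intro div_mult_self1) simp
      ultimately show ?thesis by (simp only: add.commute)
    qed
    ultimately show ?thesis using spec[OF cf, of c] spec[OF cg, of c] by linarith
  qed
  moreover have "\<forall>v\<in>V \<union> W. h v \<in> L v" using f(1) g(1) unfolding h_def by auto
  moreover have "\<forall>u\<in>V \<union> W. \<forall>v\<in>V \<union> W. (u, v) \<in> E \<longrightarrow> h u \<noteq> h v"
    using f(2) g(2) E unfolding h_def by auto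
  ultimately show "\<exists>f F'. (\<forall>v\<in>V \<union> W. f v \<in> L v) \<and>
      (\<forall>u\<in>V \<union> W. \<forall>v\<in>V \<union> W. (u, v) \<in> E \<longrightarrow> f u \<noteq> f v) \<and>
      finite F' \<and> card F' \<le> (card (V \<union> W) + p) mod k \<and>
      (\<forall>c. card {v \<in> V \<union> W. f v = c} + of_bool (c \<in> F) \<le> (card (V \<union> W) + p) div k + of_bool (c \<in> F'))"
    using F2 by (intro exI[of _ h] exI[of _ F2]) auto
qed

lemma extendable_Union:
  assumes "finite S" "\<And>X. X \<in> S \<Longrightarrow> finite X" "\<And>X. X \<in> S \<Longrightarrow> extendable k X E"
    and "\<And>X Y. X \<in> S \<Longrightarrow> Y \<in> S \<Longrightarrow> X \<noteq> Y \<Longrightarrow> X \<inter> Y = {}"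
    and "\<And>X u v. X \<in> S \<Longrightarrow> (u, v) \<in> E \<Longrightarrow> u \<in> X \<longleftrightarrow> v \<in> X"
  shows "extendable k (\<Union>S) E"
  using assms
proof (induction S rule: finite_induct)
  case empty
  then show ?case by (simp add: extendable_empty)
next
  case (insert X S)
  have "X \<inter> Y = {}" if "Y \<in> S" for Y
    using that insert.hyps(2) insert.prems(3)[of X Y] by auto
  then have "X \<inter> \<Union>S = {}" by auto
  moreover have "extendable k (\<Union>S) E" using insert.IH insert.prems by simp
  moreover have "finite (\<Union>S)" using insert by auto
  ultimately show ?case
    using insert.prems by (simp del: Un_iff add: extendable_Un)
qed

text \<open>\<open>i div k\<close> is injective on a color class. Only a color in the last,
  incomplete block can use more than the \<open>N div k\<close> full blocks.\<close>

lemma card_color_class_le: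
  assumes "0 < k" "\<And>i j. i < j \<Longrightarrow> j < N \<Longrightarrow> i div k = j div k \<Longrightarrow> g i \<noteq> g j"
  shows "card {i. i < N \<and> g i = c} \<le> N div k + of_bool (c \<in> g ` {k * (N div k)..<N})"
proof -
  let ?S = "{i. i < N \<and> g i = c}"
  have inj: "inj_on (\<lambda>i. i div k) ?S"
  proof (rule inj_onI)
    fix i j assume ij: "i \<in> ?S" "j \<in> ?S" "i div k = j div k"
    show "i = j"
    proof (rule ccontr)
      assume "i \<noteq> j"
      then consider "i < j" | "j < i" by linarith
      then show False using assms(2)[of i j] assms(2)[of j i] ij by cases auto
    qed
  qed
  show ?thesis
  proof (cases "c \<in> g ` {k * (N div k)..<N}")
    case True
    have "card ?S = card ((\<lambda>i. i div k) ` ?S)" using inj by (simp add: card_image)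
    also have "\<dots> \<le> card {..N div k}" by (rule card_mono) (auto intro!: div_le_mono)
    finally show ?thesis using True by simp
  next
    case False
    have "i div k < N div k" if "i \<in> ?S" for i
    proof -
      have "i < k * (N div k)" using False that by force
      then show ?thesis using assms(1) by (simp add: div_less_iff_less_mult mult.commute)
    qed
    have "card ?S = card ((\<lambda>i. i div k) ` ?S)" using inj by (simp add: card_image)
    also have "\<dots> \<le> card {..<N div k}"
      using \<open>\<And>i. i \<in> ?S \<Longrightarrow> i div k < N div k\<close> by (intro card_mono) auto
    finally show ?thesis by simp
  qed
qed

text \<open>Padding the inherited colors to exactly \<open>p\<close> lets them fill all positions
  below \<open>p\<close>; extra colors only strengthen what the coloring must satisfy.\<close>

lemma ex_superset_card_eq:
  assumes "finite (F :: nat set)" "card F \<le> p"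
  shows "\<exists>F'. F \<subseteq> F' \<and> finite F' \<and> card F' = p"
proof -
  have "infinite (- F)" using assms(1) by simp
  then obtain T where T: "T \<subseteq> - F" "finite T" "card T = p - card F"
    using infinite_arbitrarily_large by blast
  then have "card (F \<union> T) = p" using assms by (subst card_Un_disjoint) auto
  then show ?thesis using T(2) assms(1) by (intro exI[of _ "F \<union> T"]) auto
qed

lemma extendable_blockI:
  assumes h: "bij_betw h {..<n} V" and k: "0 < k"
    and step: "\<And>p (d :: nat \<Rightarrow> nat) M. p < k \<Longrightarrow> inj_on d {..<p} \<Longrightarrow>
      (\<And>j. p \<le> j \<Longrightarrow> j < p + n \<Longrightarrow> card (M j) = k) \<Longrightarrow>
      \<exists>g. (\<forall>i<p. g i = d i) \<and> (\<forall>j. p \<le> j \<longrightarrow> j < p + n \<longrightarrow> g j \<in> M j) \<and>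
        (\<forall>i j. i < j \<longrightarrow> j < p + n \<longrightarrow> i div k = j div k \<longrightarrow> g i \<noteq> g j) \<and>
        (\<forall>i<n. \<forall>j<n. (h i, h j) \<in> E \<longrightarrow> g (p + i) \<noteq> g (p + j))"
  shows "extendable k V E"
proof (rule extendableI)
  fix L :: "'a \<Rightarrow> nat set" and p :: nat and F :: "nat set"
  assume L: "\<forall>v\<in>V. card (L v) = k" and p: "p < k" and F: "finite F" "card F \<le> p"
  obtain F0 where F0: "F \<subseteq> F0" "finite F0" "card F0 = p" using ex_superset_card_eq[OF F] by auto
  obtain d where d: "bij_betw d {0..<p} F0" using ex_bij_betw_nat_finite[OF F0(2)] F0(3) by auto
  then have inj: "inj_on d {..<p}" and dF0: "d ` {..<p} = F0" by (auto simp: bij_betw_def lessThan_atLeast0)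
  have hV: "h i \<in> V" if "i < n" for i using h that by (auto simp: bij_betw_def)
  have "card (L (h (j - p))) = k" if "p \<le> j" "j < p + n" for j using L hV[of "j - p"] that by auto
  then obtain g where g: "\<forall>i<p. g i = d i" "\<forall>j. p \<le> j \<longrightarrow> j < p + n \<longrightarrow> g j \<in> L (h (j - p))"
    "\<forall>i j. i < j \<longrightarrow> j < p + n \<longrightarrow> i div k = j div k \<longrightarrow> g i \<noteq> g j"
    "\<forall>i<n. \<forall>j<n. (h i, h j) \<in> E \<longrightarrow> g (p + i) \<noteq> g (p + j)"
    using step[OF p inj, of "\<lambda>j. L (h (j - p))"] by auto
  define N where "N = p + n"
  define h' where "h' = the_inv_into {..<n} h"
  define f where "f v = g (p + h' v)" for v
  define F' where "F' = g ` {k * (N div k)..<N}"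
  have fh: "f (h i) = g (p + i)" if "i < n" for i
    using h that unfolding f_def h'_def by (simp add: bij_betw_def the_inv_into_f_f)
  have surj: "\<exists>i<n. v = h i" if "v \<in> V" for v using h that by (auto simp: bij_betw_def)
  have cV: "card V = n" using bij_betw_same_card[OF h] by simp
  have "card F' \<le> N mod k"
  proof -
    have "card F' \<le> card {k * (N div k)..<N}" unfolding F'_def by (rule card_image_le) simp
    then show ?thesis by (simp add: minus_mult_div_eq_mod)
  qed
  moreover have "card {v \<in> V. f v = c} + of_bool (c \<in> F) \<le> N div k + of_bool (c \<in> F')" for c
  proof -
    define A where "A = {i. i < n \<and> g (p + i) = c}"
    define B where "B = {i. i < p \<and> g i = c}"
    have "v \<in> h ` A" if v: "v \<in> V" "f v = c" for v
    proof -
      obtain i where "i < n" "v = h i" using surj[OF v(1)] by blast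
      then show ?thesis using v(2) fh unfolding A_def by auto
    qed
    then have "{v \<in> V. f v = c} = h ` A" using fh hV unfolding A_def by auto
    moreover have "inj_on h A" using h unfolding A_def by (auto simp: bij_betw_def inj_on_def)
    ultimately have cA: "card {v \<in> V. f v = c} = card A" by (simp add: card_image)
    \<comment> \<open>An inherited color counts as one use at a position below \<open>p\<close>, so
      the bound for all positions yields the one for \<open>V\<close>.\<close>
    have cB: "of_bool (c \<in> F) \<le> card B"
    proof (cases "c \<in> F")
      case True
      then obtain i where "i < p" "c = d i" using F0(1) dF0 by auto
      then have "B \<noteq> {}" using g(1) unfolding B_def by auto
      then have "0 < card B" unfolding B_def by (simp add: card_gt_0_iff)
      then show ?thesis by simp
    qed simp
    have "{i. i < N \<and> g i = c} = B \<union> (+) p ` A"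
    proof -
      have "i \<in> (+) p ` A" if "i < N" "g i = c" "\<not> i < p" for i
        using that unfolding A_def N_def by (intro image_eqI[of _ _ "i - p"]) auto
      then show ?thesis unfolding A_def B_def N_def by auto
    qed
    moreover have "B \<inter> (+) p ` A = {}" unfolding B_def by auto
    moreover have "finite A" "finite B" unfolding A_def B_def by auto
    ultimately have "card {i. i < N \<and> g i = c} = card B + card A"
      by (simp add: card_Un_disjoint card_image)
    moreover have "card {i. i < N \<and> g i = c} \<le> N div k + of_bool (c \<in> F')"
      unfolding F'_def using k g(3) unfolding N_def by (intro card_color_class_le) auto
    ultimately show ?thesis using cA cB by linarith
  qed
  moreover have "f v \<in> L v" if v: "v \<in> V" for v
  proof -
    obtain i where i: "i < n" "v = h i" using surj[OF v] by blast
    then show ?thesis using spec[OF g(2), of "p + i"] fh by simp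
  qed
  moreover have "f u \<noteq> f v" if uv: "u \<in> V" "v \<in> V" "(u, v) \<in> E" for u v
  proof -
    obtain i j where "i < n" "u = h i" "j < n" "v = h j" using surj[OF uv(1)] surj[OF uv(2)] by blast
    then show ?thesis using g(4) fh uv(3) by auto
  qed
  moreover have "finite F'" unfolding F'_def by simp
  moreover have "card V + p = N" unfolding N_def cV by simp
  ultimately show "\<exists>f F'. (\<forall>v\<in>V. f v \<in> L v) \<and> (\<forall>u\<in>V. \<forall>v\<in>V. (u, v) \<in> E \<longrightarrow> f u \<noteq> f v) \<and>
        finite F' \<and> card F' \<le> (card V + p) mod k \<and>
        (\<forall>c. card {v \<in> V. f v = c} + of_bool (c \<in> F) \<le> (card V + p) div k + of_bool (c \<in> F'))"
    by (intro exI[of _ f] exI[of _ F']) simp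
qed

text \<open>Two positions in one block differ by less than \<open>k\<close>, as do the ends of every
  edge, so a coloring that is rainbow on each window of \<open>k\<close> positions handles
  both.\<close>

lemma extendable_if_bandwidth_less:
  assumes h: "bij_betw h {..<n} V" and k: "0 < k"
    and E: "\<And>i j. i < n \<Longrightarrow> j < n \<Longrightarrow> (h i, h j) \<in> E \<Longrightarrow> i \<noteq> j \<and> j < i + k \<and> i < j + k"
  shows "extendable k V E"
proof (rule extendable_blockI[OF h k])
  fix p and d :: "nat \<Rightarrow> nat" and M
  assume "p < k" "inj_on d {..<p}" "\<And>j. p \<le> j \<Longrightarrow> j < p + n \<Longrightarrow> card (M j :: nat set) = k"
  then obtain g where g: "\<forall>i<p. g i = d i" "\<forall>j. p \<le> j \<longrightarrow> j < p + n \<longrightarrow> g j \<in> M j"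
    "\<forall>i j. i < j \<longrightarrow> j < p + n \<longrightarrow> j < i + k \<longrightarrow> g i \<noteq> g j"
    using greedy_coloring[of p k d "p + n" M] by auto
  have "g i \<noteq> g j" if "i < j" "j < p + n" "i div k = j div k" for i j
  proof -
    have "j div k * k \<le> i" unfolding that(3)[symmetric] by simp
    moreover have "j div k * k + j mod k = j" "j mod k < k" using k by simp_all
    ultimately have "j < i + k" by linarith
    then show ?thesis using g(3) that by blast
  qed
  moreover have "g (p + i) \<noteq> g (p + j)" if ij: "i < n" "j < n" "(h i, h j) \<in> E" for i j
  proof -
    consider "i < j" "j < i + k" | "j < i" "i < j + k" using E[OF ij] by linarith
    then show ?thesis
    proof cases
      case 1
      then show ?thesis using spec[OF spec[OF g(3), of "p + i"], of "p + j"] ij by simp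
    next
      case 2
      then show ?thesis using spec[OF spec[OF g(3), of "p + j"], of "p + i"] ij by simp
    qed
  qed
  ultimately show "\<exists>g. (\<forall>i<p. g i = d i) \<and> (\<forall>j. p \<le> j \<longrightarrow> j < p + n \<longrightarrow> g j \<in> M j) \<and>
      (\<forall>i j. i < j \<longrightarrow> j < p + n \<longrightarrow> i div k = j div k \<longrightarrow> g i \<noteq> g j) \<and>
      (\<forall>i<n. \<forall>j<n. (h i, h j) \<in> E \<longrightarrow> g (p + i) \<noteq> g (p + j))"
    using g(1,2) by (intro exI[of _ g]) auto
qed

definition cycle_square_adj :: "nat \<Rightarrow> nat \<Rightarrow> nat \<Rightarrow> bool" where
  "cycle_square_adj n i j \<longleftrightarrow> i \<noteq> j \<and> (\<exists>a\<in>{1, 2}. j = (i + a) mod n \<or> i = (j + a) mod n)"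

lemma cycle_square_block_coloring:
  fixes d :: "nat \<Rightarrow> nat"
  assumes n: "6 \<le> n" and p: "p < 4" and d: "inj_on d {..<p}"
    and M: "\<And>j. p \<le> j \<Longrightarrow> j < p + n \<Longrightarrow> card (M j) = 4"
  shows "\<exists>g. (\<forall>i<p. g i = d i) \<and> (\<forall>j. p \<le> j \<longrightarrow> j < p + n \<longrightarrow> g j \<in> M j) \<and> block_proper (p + n) g \<and>
    g (p + n - 1) \<noteq> g p \<and> g (p + n - 1) \<noteq> g (p + 1) \<and> g (p + n - 2) \<noteq> g p"
proof -
  consider "n = 6" | "n = 7" "p = 1" | "7 \<le> n" "n = 7 \<Longrightarrow> p \<noteq> 1" using n by linarith
  then show ?thesis
  proof cases
    case 1
    then show ?thesis using hexagon_square_block_coloring[OF p d, of "p + n" M] M by simp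
  next
    case 2
    then obtain g where "g 0 = d 0" "\<forall>j. 1 \<le> j \<longrightarrow> j < 8 \<longrightarrow> g j \<in> M j" "block_proper 8 g"
      "g 7 \<noteq> g 1" "g 7 \<noteq> g 2" "g 6 \<noteq> g 1"
      using heptagon_square_block_coloring[of M "d 0"] M by auto
    then show ?thesis using 2 by (intro exI[of _ g]) (auto simp: numeral_2_eq_2)
  next
    case 3
    then show ?thesis using cycle_square_block_coloring_general[OF 3 p d refl, of M] M by simp
  qed
qed

lemma extendable_cycle_square_4:
  assumes h: "bij_betw h {..<n} V" and n: "6 \<le> n"
    and E: "\<And>i j. i < n \<Longrightarrow> j < n \<Longrightarrow> (h i, h j) \<in> E \<Longrightarrow> cycle_square_adj n i j"
  shows "extendable 4 V E"
proof (rule extendable_blockI[OF h])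
  fix p and d :: "nat \<Rightarrow> nat" and M
  assume "p < 4" "inj_on d {..<p}" "\<And>j. p \<le> j \<Longrightarrow> j < p + n \<Longrightarrow> card (M j :: nat set) = 4"
  then obtain g where g: "\<forall>i<p. g i = d i" "\<forall>j. p \<le> j \<longrightarrow> j < p + n \<longrightarrow> g j \<in> M j" "block_proper (p + n) g"
    "g (p + n - 1) \<noteq> g p" "g (p + n - 1) \<noteq> g (p + 1)" "g (p + n - 2) \<noteq> g p"
    using cycle_square_block_coloring[OF n, of p d M] by auto
  have arc: "g (p + i) \<noteq> g (p + (i + a) mod n)" if a: "i < n" "a \<in> {1, 2}" for i a
  proof (cases "i + a < n")
    case True
    then have "block_adj (p + i) (p + (i + a))" using a unfolding block_adj_def by auto
    then show ?thesis using g(3) True unfolding block_proper_def by auto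
  next
    case False
    then have "(i + a) mod n = i + a - n" using a n by (subst le_mod_geq) auto
    \<comment> \<open>Exactly three arcs wrap around; they are the three inequalities that accompany
      \<open>block_proper\<close>.\<close>
    from False a n consider "i = n - 1" "a = 1" | "i = n - 1" "a = 2" | "i = n - 2" "a = 2"
      by fastforce
    then show ?thesis
    proof cases
      case 1
      then have "i + a - n = 0" "p + i = p + n - 1" using n by simp_all
      then show ?thesis using g(4) \<open>(i + a) mod n = i + a - n\<close> by simp
    next
      case 2
      then have "i + a - n = 1" "p + i = p + n - 1" using n by simp_all
      then show ?thesis using g(5) \<open>(i + a) mod n = i + a - n\<close> by simp
    next
      case 3
      then have "i + a - n = 0" "p + i = p + n - 2" using n by simp_all
      then show ?thesis using g(6) \<open>(i + a) mod n = i + a - n\<close> by simp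
    qed
  qed
  have "g (p + i) \<noteq> g (p + j)" if ij: "i < n" "j < n" "(h i, h j) \<in> E" for i j
    using E[OF ij] arc[OF ij(1)] arc[OF ij(2)] unfolding cycle_square_adj_def by metis
  moreover have "g i \<noteq> g j" if "i < j" "j < p + n" "i div 4 = j div 4" for i j
    using g(3) that unfolding block_proper_def block_adj_def by blast
  ultimately show "\<exists>g. (\<forall>i<p. g i = d i) \<and> (\<forall>j. p \<le> j \<longrightarrow> j < p + n \<longrightarrow> g j \<in> M j) \<and>
      (\<forall>i j. i < j \<longrightarrow> j < p + n \<longrightarrow> i div 4 = j div 4 \<longrightarrow> g i \<noteq> g j) \<and>
      (\<forall>i<n. \<forall>j<n. (h i, h j) \<in> E \<longrightarrow> g (p + i) \<noteq> g (p + j))"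
    using g(1,2) by (intro exI[of _ g]) auto
qed simp

text \<open>A length divisible by 3 leaves the remainder \<open>p\<close> unchanged, so the
  inherited block is passed on as \<open>F' = F\<close>. The cycle is cut into its own triples of
  consecutive vertices, which are triangles in the square, and this bounds each color class.\<close>

lemma extendable_cycle_square_3:
  assumes h: "bij_betw h {..<n} V" and n: "3 dvd n" "0 < n"
    and E: "\<And>i j. i < n \<Longrightarrow> j < n \<Longrightarrow> (h i, h j) \<in> E \<Longrightarrow> cycle_square_adj n i j"
  shows "extendable 3 V E"
proof (rule extendableI)
  fix L :: "'a \<Rightarrow> nat set" and p :: nat and F :: "nat set"
  assume L: "\<forall>v\<in>V. card (L v) = 3" and p: "p < 3" and F: "finite F" "card F \<le> p"
  have hV: "h i \<in> V" if "i < n" for i using h that by (auto simp: bij_betw_def)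
  obtain f where f: "\<forall>i<n. f i \<in> L (h i) \<and> f i \<noteq> f ((i + 1) mod n) \<and> f i \<noteq> f ((i + 2) mod n)"
    using cycle_square_3_choosable[OF n, of "\<lambda>i. L (h i)"] L hV by auto
  define h' where "h' = the_inv_into {..<n} h"
  have h': "h' (h i) = i" if "i < n" for i
    using h that unfolding h'_def by (simp add: bij_betw_def the_inv_into_f_f)
  have surj: "\<exists>i<n. v = h i" if "v \<in> V" for v using h that by (auto simp: bij_betw_def)
  obtain m where m: "n = 3 * m" using n(1) by blast
  have cV: "card V = n" using bij_betw_same_card[OF h] by simp
  have cl: "card {v \<in> V. f (h' v) = c} \<le> m" for c
  proof -
    have "v \<in> h ` {i. i < n \<and> f i = c}" if v: "v \<in> V" "f (h' v) = c" for v
    proof -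
      obtain i where "i < n" "v = h i" using surj[OF v(1)] by blast
      then show ?thesis using v(2) h' by auto
    qed
    then have "{v \<in> V. f (h' v) = c} \<subseteq> h ` {i. i < n \<and> f i = c}" by auto
    then have "card {v \<in> V. f (h' v) = c} \<le> card (h ` {i. i < n \<and> f i = c})"
      by (intro card_mono) auto
    also have "\<dots> \<le> card {i. i < n \<and> f i = c}" by (rule card_image_le) simp
    also have "\<dots> \<le> n div 3 + of_bool (c \<in> f ` {3 * (n div 3)..<n})"
    proof (rule card_color_class_le)
      fix i j assume ij: "i < j" "j < n" "i div 3 = j div 3"
      then have "j = i + 1 \<or> j = i + 2" by auto
      then show "f i \<noteq> f j" using f ij by (metis less_trans mod_less)
    qed simp
    also have "\<dots> = m" unfolding m by simp
    finally show ?thesis .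
  qed
  have "f (h' u) \<noteq> f (h' v)" if uv: "u \<in> V" "v \<in> V" "(u, v) \<in> E" for u v
  proof -
    obtain i j where ij: "i < n" "u = h i" "j < n" "v = h j" using surj[OF uv(1)] surj[OF uv(2)] by blast
    have "cycle_square_adj n i j" using E ij uv(3) by blast
    then have "f i \<noteq> f j" using f ij(1,3) unfolding cycle_square_adj_def by (metis insertE singletonD)
    then show ?thesis using h' ij by simp
  qed
  moreover have "f (h' v) \<in> L v" if v: "v \<in> V" for v
  proof -
    obtain i where "i < n" "v = h i" using surj[OF v] by blast
    then show ?thesis using f h' by simp
  qed
  moreover have "(card V + p) mod 3 = p" "(card V + p) div 3 = m" unfolding cV m using p by simp_all
  ultimately show "\<exists>f F'. (\<forall>v\<in>V. f v \<in> L v) \<and> (\<forall>u\<in>V. \<forall>v\<in>V. (u, v) \<in> E \<longrightarrow> f u \<noteq> f v) \<and>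
        finite F' \<and> card F' \<le> (card V + p) mod 3 \<and>
        (\<forall>c. card {v \<in> V. f v = c} + of_bool (c \<in> F) \<le> (card V + p) div 3 + of_bool (c \<in> F'))"
    using F cl by (intro exI[of _ "\<lambda>v. f (h' v)"] exI[of _ F]) simp
qed

section \<open>Components and squares\<close>

lemma pair_wf_path_graph: "pair_wf_digraph (path_graph n)"
  by unfold_locales (auto simp: path_graph_def)

lemma pair_wf_cycle_graph: "pair_wf_digraph (cycle_graph n)"
  by unfold_locales (auto simp: cycle_graph_def)

lemma parcs_graph_square_iff:
  assumes "pair_wf_digraph H"
  shows "(u, v) \<in> parcs (graph_square H) \<longleftrightarrow> u \<in> pverts H \<and> v \<in> pverts H \<and> u \<noteq> v \<and>
    ((u, v) \<in> parcs H \<or> (\<exists>w. (u, w) \<in> parcs H \<and> (w, v) \<in> parcs H))"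
proof -
  interpret pair_wf_digraph H by fact
  have cost: "awalk_cost (\<lambda>_. 1) p = length p" for p :: "('a \<times> 'a) list"
    by (induction p) auto
  have "\<mu> (\<lambda>_. 1) u v \<le> 2 \<longleftrightarrow> (u, v) \<in> parcs H \<or> (\<exists>w. (u, w) \<in> parcs H \<and> (w, v) \<in> parcs H)"
    if uv: "u \<in> pverts H" "v \<in> pverts H" "u \<noteq> v"
  proof
    assume "\<mu> (\<lambda>_. 1) u v \<le> 2"
    \<comment> \<open>A strict bound on an infimum yields an actual walk; as its cost is an integer,
      below 3 means at most two arcs.\<close>
    then have "\<mu> (\<lambda>_. 1) u v < ereal 3" by (rule le_less_trans) simp
    then obtain p where p: "awalk u p v" "ereal (awalk_cost (\<lambda>_. 1) p) < ereal 3"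
      unfolding \<mu>_def by (auto simp: INF_less_iff)
    then have "length p < 3" unfolding cost by simp
    then consider "p = []" | e where "p = [e]" | e e' where "p = [e, e']"
      by (cases p; cases "tl p"; cases "tl (tl p)") auto
    then show "(u, v) \<in> parcs H \<or> (\<exists>w. (u, w) \<in> parcs H \<and> (w, v) \<in> parcs H)"
      using p(1) uv(3) by cases (auto simp: awalk_def)
  next
    assume "(u, v) \<in> parcs H \<or> (\<exists>w. (u, w) \<in> parcs H \<and> (w, v) \<in> parcs H)"
    then show "\<mu> (\<lambda>_. 1) u v \<le> 2"
    proof (elim disjE exE conjE)
      assume "(u, v) \<in> parcs H"
      then have "awalk u [(u, v)] v" using uv by (simp add: awalk_def)
      from min_cost_le_walk_cost[OF this, of "\<lambda>_. 1"] have "\<mu> (\<lambda>_. 1) u v \<le> 1" by (simp add: cost one_ereal_def)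
      also have "(1 :: ereal) \<le> 2" by simp
      finally show ?thesis .
    next
      fix w assume "(u, w) \<in> parcs H" "(w, v) \<in> parcs H"
      then have "awalk u [(u, w), (w, v)] v" using uv by (simp add: awalk_def)
      from min_cost_le_walk_cost[OF this, of "\<lambda>_. 1"] show ?thesis by (simp add: cost)
    qed
  qed
  then show ?thesis unfolding graph_square_def by auto
qed

lemma pverts_graph_square [simp]: "pverts (graph_square H) = pverts H"
  by (simp add: graph_square_def)

lemma pverts_path_graph [simp]: "pverts (path_graph n) = {..<n}"
  by (simp add: path_graph_def)

lemma pverts_cycle_graph [simp]: "pverts (cycle_graph n) = {..<n}"
  by (simp add: cycle_graph_def)

lemma parcs_square_path_graphD:
  "(i, j) \<in> parcs (graph_square (path_graph n)) \<Longrightarrow> i \<noteq> j \<and> j < i + 3 \<and> i < j + 3"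
  unfolding parcs_graph_square_iff[OF pair_wf_path_graph] by (auto simp: path_graph_def)

lemma parcs_square_cycle_graph_iff:
  assumes "3 \<le> n" "i < n" "j < n"
  shows "(i, j) \<in> parcs (graph_square (cycle_graph n)) \<longleftrightarrow> cycle_square_adj n i j"
proof -
  have arc: "(i, j) \<in> parcs (cycle_graph n) \<longleftrightarrow> i < n \<and> j < n \<and> (j = (i + 1) mod n \<or> i = (j + 1) mod n)" for i j
    by (simp add: cycle_graph_def)
  have inj: "i = j" if "i < n" "j < n" "(i + 1) mod n = (j + 1) mod n" for i j
  proof -
    have "(k + 1) mod n = (if k + 1 = n then 0 else k + 1)" if "k < n" for k using that by auto
    then show ?thesis using that by (auto split: if_splits)
  qed
  have two: "((i + 1) mod n + 1) mod n = (i + 2) mod n" for i by (simp add: mod_simps)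
  have lt: "(i + 1) mod n < n" for i using assms(1) by simp
  show ?thesis
  proof
    assume "(i, j) \<in> parcs (graph_square (cycle_graph n))"
    then have ne: "i \<noteq> j" and
      "(i, j) \<in> parcs (cycle_graph n) \<or> (\<exists>w. (i, w) \<in> parcs (cycle_graph n) \<and> (w, j) \<in> parcs (cycle_graph n))"
      unfolding parcs_graph_square_iff[OF pair_wf_cycle_graph] by auto
    from this(2) show "cycle_square_adj n i j"
    proof (elim disjE exE conjE)
      assume "(i, j) \<in> parcs (cycle_graph n)"
      then show ?thesis using ne unfolding arc cycle_square_adj_def by blast
    next
      fix w assume w: "(i, w) \<in> parcs (cycle_graph n)" "(w, j) \<in> parcs (cycle_graph n)"
      then consider "w = (i + 1) mod n" "j = (w + 1) mod n" | "w = (i + 1) mod n" "w = (j + 1) mod n"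
        | "i = (w + 1) mod n" "j = (w + 1) mod n" | "i = (w + 1) mod n" "w = (j + 1) mod n"
        unfolding arc by blast
      then show ?thesis
      proof cases
        case 1
        then have "j = (i + 2) mod n" using two by simp
        then show ?thesis using ne unfolding cycle_square_adj_def by blast
      next
        case 2
        then show ?thesis using inj[OF assms(2,3)] ne by simp
      next
        case 3
        then show ?thesis using ne by simp
      next
        case 4
        then have "i = (j + 2) mod n" using two by simp
        then show ?thesis using ne unfolding cycle_square_adj_def by blast
      qed
    qed
  next
    assume adj: "cycle_square_adj n i j"
    have "(k, (k + 1) mod n) \<in> parcs (cycle_graph n)" "((k + 1) mod n, k) \<in> parcs (cycle_graph n)" if "k < n" for k
      using that lt unfolding arc by auto
    note a = this
    from adj consider "j = (i + 1) mod n" | "i = (j + 1) mod n" | "j = (i + 2) mod n" | "i = (j + 2) mod n"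
      unfolding cycle_square_adj_def by blast
    then have "(i, j) \<in> parcs (cycle_graph n) \<or> (\<exists>w. (i, w) \<in> parcs (cycle_graph n) \<and> (w, j) \<in> parcs (cycle_graph n))"
    proof cases
      case 1
      then show ?thesis using a(1)[OF assms(2)] by simp
    next
      case 2
      then show ?thesis using a(2)[OF assms(3)] by simp
    next
      case 3
      then show ?thesis using a(1)[OF assms(2)] a(1)[OF lt[of i]] unfolding two by blast
    next
      case 4
      then show ?thesis using a(2)[OF assms(3)] a(2)[OF lt[of j]] unfolding two by blast
    qed
    then show "(i, j) \<in> parcs (graph_square (cycle_graph n))"
      using adj assms unfolding parcs_graph_square_iff[OF pair_wf_cycle_graph] cycle_square_adj_def by auto
  qed
qed

section \<open>Components as strongly connected components\<close>

lemma (in wf_digraph) strongly_connected_imp_connected: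
  "strongly_connected G \<Longrightarrow> Digraph_Component.connected G"
  unfolding strongly_connected_def by (intro connectedI) (auto intro: reachable_mk_symmetricI)

context pair_graph
begin

lemma connected_induced_imp_strongly_connected:
  assumes "induced_subgraph C (with_proj G)" "Digraph_Component.connected C"
  shows "strongly_connected C"
proof -
  interpret C: wf_digraph C using assms(1) by (auto simp: induced_subgraph_def subgraph_def)
  show ?thesis
    using assms(2) induced_graph_imp_symmetric[OF sym_arcs assms(1)]
    by (intro C.symmetric_connected_imp_strongly_connected)
qed

text \<open>Gives access to the theory of strongly connected components. The two notions agree on
  induced subgraphs of a symmetric digraph, but not on all subgraphs, since a subgraph may keep only
  one of two opposite arcs.\<close>

lemma components_eq_sccs: "components G = sccs"
proof (intro equalityI subsetI)
  fix C assume "C \<in> components G"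
  then have max: "max_subgraph Digraph_Component.connected C" by (simp add: components_def)
  \<comment> \<open>Connectedness survives adding arcs on the same vertices, so a maximal connected
    subgraph is induced.\<close>
  have "arc_mono (Digraph_Component.connected :: ('a, 'a \<times> 'a) pre_digraph \<Rightarrow> bool)"
    unfolding arc_mono_def
  proof (intro allI impI, elim conjE)
    fix H1 H2 :: "('a, 'a \<times> 'a) pre_digraph"
    assume H: "Digraph_Component.connected H1" "subgraph H1 H2" "verts H1 = verts H2"
    interpret H2: wf_digraph H2 using H(2) by (simp add: subgraph_def)
    show "Digraph_Component.connected H2"
      using H by (intro H2.connected_spanning_imp_connected[of H1]) (simp_all add: spanning_def)
  qed
  with max have ind: "induced_subgraph C (with_proj G)" by (rule induced_subgraphI_arc_mono)
  have "max_subgraph strongly_connected C"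
  proof (rule max_subgraphI)
    show "strongly_connected C"
      using ind max_subgraph_prop[OF max] by (rule connected_induced_imp_strongly_connected)
    show "subgraph C (with_proj G)" using ind by (rule induced_imp_subgraph)
    fix H assume H: "C \<noteq> H" "subgraph C H" "subgraph H (with_proj G)"
    interpret H: wf_digraph H using H(2) by (simp add: subgraph_def)
    have "\<not> Digraph_Component.connected H" using max H unfolding max_subgraph_def by auto
    then show "\<not> strongly_connected H" using H.strongly_connected_imp_connected by blast
  qed
  then show "C \<in> sccs" by (simp add: sccs_altdef2)
next
  fix C assume C: "C \<in> sccs"
  then have max: "max_subgraph strongly_connected C" by (simp add: sccs_altdef2)
  have ind: "induced_subgraph C (with_proj G)" using C by (rule in_sccs_imp_induced)
  interpret C: wf_digraph C using ind by (auto simp: induced_subgraph_def subgraph_def)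
  have "max_subgraph Digraph_Component.connected C"
  proof (rule max_subgraphI)
    show "Digraph_Component.connected C"
      using max_subgraph_prop[OF max] by (rule C.strongly_connected_imp_connected)
    show "subgraph C (with_proj G)" using ind by (rule induced_imp_subgraph)
    fix H assume H: "C \<noteq> H" "subgraph C H" "subgraph H (with_proj G)"
    \<comment> \<open>\<open>H\<close> itself need not be symmetric; the induced subgraph on its
      vertices is, and there connectedness gives strong connectedness.\<close>
    define K where "K = with_proj G \<restriction> verts H"
    have HK: "subgraph H K" unfolding K_def using H(3) by (rule subgraph_induce_subgraphI2)
    have K: "induced_subgraph K (with_proj G)" unfolding K_def
      using subgraph_imp_subverts[OF H(3)] by (intro induced_induce) simp
    interpret K: wf_digraph K using HK by (simp add: subgraph_def)
    have vK: "verts K = verts H" unfolding K_def by simp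
    show "\<not> Digraph_Component.connected H"
    proof
      assume "Digraph_Component.connected H"
      then have "Digraph_Component.connected K"
        using HK vK by (intro K.connected_spanning_imp_connected[of H]) (simp_all add: spanning_def)
      with K have "strongly_connected K" by (rule connected_induced_imp_strongly_connected)
      moreover have "subgraph C K" using H(2) HK by (rule subgraph_trans)
      moreover have "subgraph K (with_proj G)" using K by (rule induced_imp_subgraph)
      ultimately have "K = C" using max unfolding max_subgraph_def by auto
      then have "C = H" using H(2) HK by (auto simp: subgraph_def compatible_def)
      then show False using H(1) by simp
    qed
  qed
  then show "C \<in> components G" by (simp add: components_def)
qed

lemma component_induced: "C \<in> components G \<Longrightarrow> induced_subgraph C (with_proj G)"
  unfolding components_eq_sccs by (rule in_sccs_imp_induced)

lemma verts_components: "verts ` components G = sccs_verts"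
  unfolding components_eq_sccs sccs_verts_conv ..

lemma Union_verts_components: "\<Union>(verts ` components G) = pverts G"
proof (intro equalityI subsetI)
  fix u assume "u \<in> \<Union>(verts ` components G)"
  then show "u \<in> pverts G"
    using component_induced by (auto simp: induced_subgraph_def subgraph_def)
next
  fix u assume "u \<in> pverts G"
  then have "scc_of u \<in> sccs_verts" "u \<in> scc_of u"
    by (auto intro: scc_of_in_sccs_verts in_scc_of_self)
  then show "u \<in> \<Union>(verts ` components G)" unfolding verts_components by blast
qed

lemma component_closed:
  assumes "X \<in> verts ` components G" "(u, v) \<in> parcs G"
  shows "u \<in> X \<longleftrightarrow> v \<in> X"
proof -
  have "u \<rightarrow>\<^sup>*\<^bsub>with_proj G\<^esub> v" "v \<rightarrow>\<^sup>*\<^bsub>with_proj G\<^esub> u"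
    using assms(2) graph_symmetric[of u v] by (auto intro: reachable_adjI)
  then show ?thesis
    using assms(1) unfolding verts_components in_sccs_verts_conv_reachable by blast
qed

text \<open>A subgraph inherits \<open>fst\<close> and \<open>snd\<close> as tail and head, which
  forces the arc map of the isomorphism to be the one induced by the vertex map; that
  \<open>C\<close> is induced gives the direction from \<open>G\<close> back to
  \<open>S\<close>.\<close>

lemma component_isoE:
  assumes C: "C \<in> components G" and iso: "digraph_iso (with_proj S) C"
  obtains h where "bij_betw h (pverts S) (verts C)"
    "\<And>i j. i \<in> pverts S \<Longrightarrow> j \<in> pverts S \<Longrightarrow> (h i, h j) \<in> parcs G \<longleftrightarrow> (i, j) \<in> parcs S"
proof -
  obtain f where f: "pre_digraph.digraph_isomorphism (with_proj S) f" and Cf: "C = app_iso f (with_proj S)"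
    using iso by (auto simp: digraph_iso_def)
  define h where "h = iso_verts f"
  have inj: "inj_on h (pverts S)" and wf: "wf_digraph (with_proj S)"
    using f unfolding pre_digraph.digraph_isomorphism_def h_def by auto
  have ind: "induced_subgraph C (with_proj G)" using C by (rule component_induced)
  have tl: "iso_tail f = fst" "iso_head f = snd"
    using ind unfolding Cf by (auto simp: induced_subgraph_def subgraph_def compatible_def)
  have arc: "iso_arcs f e = (h (fst e), h (snd e))" if "e \<in> parcs S" for e
    using f that unfolding pre_digraph.digraph_isomorphism_def tl h_def by (simp add: prod_eq_iff)
  have vC: "verts C = h ` pverts S" unfolding Cf h_def by simp
  have aC: "arcs C = {e \<in> parcs G. fst e \<in> verts C \<and> snd e \<in> verts C}"
    using ind by (auto simp: induced_subgraph_def)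
  have "(h i, h j) \<in> parcs G \<longleftrightarrow> (i, j) \<in> parcs S" if ij: "i \<in> pverts S" "j \<in> pverts S" for i j
  proof
    assume "(h i, h j) \<in> parcs G"
    then have "(h i, h j) \<in> arcs C" using ij unfolding aC vC by simp
    then obtain i' j' where e: "(i', j') \<in> parcs S" "(h i, h j) = iso_arcs f (i', j')" unfolding Cf by auto
    then have "h i = h i'" "h j = h j'" using arc by auto
    moreover have "i' \<in> pverts S" "j' \<in> pverts S"
      using wf_digraph.wellformed[OF wf, of "(i', j')"] e(1) by auto
    ultimately show "(i, j) \<in> parcs S" using e(1) inj ij by (metis inj_onD)
  next
    assume e: "(i, j) \<in> parcs S"
    then have "iso_arcs f (i, j) \<in> arcs C" unfolding Cf by auto
    then show "(h i, h j) \<in> parcs G" using arc[OF e] unfolding aC by simp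
  qed
  then show thesis using that[of h] inj vC by (simp add: bij_betw_def)
qed

end

lemma equitably_choosable_if_extendable:
  assumes "extendable k (pverts G) (parcs G)" "0 < k" "pair_wf_digraph G"
  shows "equitably_choosable G k"
  unfolding equitably_choosable_def
proof (intro allI impI)
  fix L :: "'a \<Rightarrow> nat set" assume "k_assignment G k L"
  then have L: "\<forall>v\<in>pverts G. card (L v) = k" by (simp add: k_assignment_def)
  obtain f F' where f: "\<forall>v\<in>pverts G. f v \<in> L v" "\<forall>u\<in>pverts G. \<forall>v\<in>pverts G. (u, v) \<in> parcs G \<longrightarrow> f u \<noteq> f v"
    and F': "finite F'" "card F' \<le> (card (pverts G) + 0) mod k"
    and c: "\<forall>c. card {v \<in> pverts G. f v = c} + of_bool (c \<in> {}) \<le> (card (pverts G) + 0) div k + of_bool (c \<in> F')"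
    by (rule extendableE[OF assms(1) L assms(2), of "{}"]) simp_all
  have "proper_list_coloring G L f"
    using f pair_wf_digraph.wellformed'[OF assms(3)] unfolding proper_list_coloring_def by auto
  moreover have "int (card {v \<in> pverts G. f v = c}) \<le> \<lceil>real (card (pverts G)) / real k\<rceil>" for c
  proof -
    define n where "n = card (pverts G)"
    have n: "real n = real k * real (n div k) + real (n mod k)"
      by (metis mult_div_mod_eq of_nat_add of_nat_mult)
    \<comment> \<open>A nonempty \<open>F'\<close> means that \<open>n mod k\<close> is positive,
      and then rounding up allows one more use than \<open>n div k\<close>.\<close>
    have "real (n div k) + of_bool (c \<in> F') < real n / real k + 1"
    proof (cases "c \<in> F'")
      case True
      then have "0 < card F'" using F'(1) by (auto simp: card_gt_0_iff)
      then have "0 < n mod k" using F'(2) unfolding n_def by simp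
      then have "real k * real (n div k) < real n" using n by linarith
      then have "real (n div k) < real n / real k" using assms(2) by (simp add: field_simps)
      then show ?thesis using True by simp
    next
      case False
      have "real k * real (n div k) \<le> real n" using n by linarith
      then have "real (n div k) \<le> real n / real k" using assms(2) by (simp add: field_simps)
      then show ?thesis using False by simp
    qed
    moreover have "card {v \<in> pverts G. f v = c} \<le> n div k + of_bool (c \<in> F')"
      using c unfolding n_def by simp
    then have "real (card {v \<in> pverts G. f v = c}) \<le> real (n div k) + of_bool (c \<in> F')"
      by (simp flip: of_nat_add split: if_splits add: of_bool_def)
    ultimately have "of_int (int (card {v \<in> pverts G. f v = c}) - 1) < real n / real k" by simp
    then have "int (card {v \<in> pverts G. f v = c}) - 1 < \<lceil>real n / real k\<rceil>" by (simp only: less_ceiling_iff)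
    then show ?thesis unfolding n_def by linarith
  qed
  ultimately show "\<exists>f. proper_list_coloring G L f \<and> equitable G k f"
    unfolding equitable_def by blast
qed

text \<open>Constant lists suffice: the obstructions for \<open>k = 3\<close> are obstructions to
  proper coloring, so equitability is dropped.\<close>

lemma equitably_choosable_imp_colorable:
  assumes "equitably_choosable G k" "0 < k"
  obtains f where "\<And>v. v \<in> pverts G \<Longrightarrow> f v < k" "\<And>u v. (u, v) \<in> parcs G \<Longrightarrow> f u \<noteq> f v"
proof -
  have "k_assignment G k (\<lambda>_. {..<k})" by (simp add: k_assignment_def)
  then obtain f where "proper_list_coloring G (\<lambda>_. {..<k}) f"
    using assms(1) unfolding equitably_choosable_def by blast
  then show thesis using that[of f] unfolding proper_list_coloring_def by auto
qed

text \<open>Unrolled along the integers, three consecutive vertices use all three colors, so the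
  fourth repeats the first. If \<open>n\<close> left remainder 1 or 2, position \<open>n\<close>
  would be adjacent to a multiple of 3, yet both would have the color of vertex 0.\<close>

lemma cycle_square_3_colorable_imp_3_dvd:
  fixes c :: "nat \<Rightarrow> nat"
  assumes n: "3 \<le> n" and c: "\<And>i. i < n \<Longrightarrow> c i < 3"
    and proper: "\<And>i j. i < n \<Longrightarrow> j < n \<Longrightarrow> cycle_square_adj n i j \<Longrightarrow> c i \<noteq> c j"
  shows "3 dvd n"
proof (rule ccontr)
  assume nd: "\<not> 3 dvd n"
  define b where "b i = c (i mod n)" for i
  have adj: "b i \<noteq> b (i + a)" if a: "a \<in> {1, 2}" for i a
  proof -
    have "i mod n \<noteq> (i + a) mod n"
    proof
      assume "i mod n = (i + a) mod n"
      then have "n dvd a" using mod_eq_dvd_iff_nat[of i "i + a" n] by simp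
      then show False using a n by (auto dest: dvd_imp_le)
    qed
    moreover have "(i + a) mod n = (i mod n + a) mod n" by (simp add: mod_simps)
    ultimately have "cycle_square_adj n (i mod n) ((i + a) mod n)"
      using a unfolding cycle_square_adj_def by blast
    then show ?thesis unfolding b_def using n by (intro proper) auto
  qed
  have b3: "b i < 3" for i unfolding b_def using n by (intro c) simp
  have "b (i + 3) = b i" for i
  proof -
    have "b i \<noteq> b (i + 1)" "b i \<noteq> b (i + 2)" "b (i + 1) \<noteq> b (i + 2)" "b (i + 1) \<noteq> b (i + 3)" "b (i + 2) \<noteq> b (i + 3)"
      using adj[of 1 i] adj[of 2 i] adj[of 1 "i + 1"] adj[of 2 "i + 1"] adj[of 1 "i + 2"]
      by (simp_all add: eval_nat_numeral)
    then show ?thesis using b3[of i] b3[of "i + 1"] b3[of "i + 2"] b3[of "i + 3"] by linarith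
  qed
  then have per: "b (3 * q) = b 0" for q
  proof (induction q)
    case (Suc q)
    have "b (3 * Suc q) = b (3 * q + 3)" by (simp add: add.commute)
    then show ?case using \<open>\<And>i. b (i + 3) = b i\<close>[of "3 * q"] Suc by simp
  qed simp
  have "n mod 3 = 1 \<or> n mod 3 = 2" using nd by (auto simp: dvd_eq_mod_eq_0)
  moreover have "n = 3 * (n div 3) + n mod 3" by simp
  moreover have "b n = b 0" unfolding b_def by simp
  ultimately show False using adj[of 1 "3 * (n div 3)"] adj[of 2 "3 * (n div 3)"] per[of "n div 3"]
    by (metis insertI1 insertI2 singletonI)
qed

context pair_graph
begin

lemma extendable_if_components:
  assumes "\<And>C. C \<in> components G \<Longrightarrow> extendable k (verts C) (parcs G)"
  shows "extendable k (pverts G) (parcs G)"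
proof -
  have fin: "finite X" if "X \<in> verts ` components G" for X
    using that Union_verts_components pair_finite_verts by (metis Union_upper finite_subset)
  have "finite (verts ` components G)"
    using Union_verts_components pair_finite_verts by (metis finite_UnionD)
  then have "extendable k (\<Union>(verts ` components G)) (parcs G)"
  proof (rule extendable_Union)
    show "X \<inter> Y = {}" if "X \<in> verts ` components G" "Y \<in> verts ` components G" "X \<noteq> Y" for X Y
      using that unfolding verts_components by (rule sccs_verts_disjoint)
  qed (use fin assms component_closed in auto)
  then show ?thesis unfolding Union_verts_components .
qed

lemma extendable_path_square:
  assumes "C \<in> components G" "is_path_square C" "3 \<le> k"
  shows "extendable k (verts C) (parcs G)"
proof -
  obtain n where iso: "digraph_iso (with_proj (graph_square (path_graph n))) C"
    using assms(2) by (auto simp: is_path_square_def)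
  obtain h where h: "bij_betw h {..<n} (verts C)"
    "\<And>i j. i < n \<Longrightarrow> j < n \<Longrightarrow> (h i, h j) \<in> parcs G \<longleftrightarrow> (i, j) \<in> parcs (graph_square (path_graph n))"
    using component_isoE[OF assms(1) iso] by auto
  show ?thesis
  proof (rule extendable_if_bandwidth_less[OF h(1)])
    fix i j assume "i < n" "j < n" "(h i, h j) \<in> parcs G"
    then have "(i, j) \<in> parcs (graph_square (path_graph n))" using h(2) by simp
    then show "i \<noteq> j \<and> j < i + k \<and> i < j + k" using assms(3) parcs_square_path_graphD by fastforce
  qed (use assms(3) in simp)
qed

lemma component_cycle_squareE:
  assumes "C \<in> components G" "is_cycle_square n C"
  obtains h where "3 \<le> n" "bij_betw h {..<n} (verts C)"
    "\<And>i j. i < n \<Longrightarrow> j < n \<Longrightarrow> (h i, h j) \<in> parcs G \<longleftrightarrow> cycle_square_adj n i j"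
proof -
  have n: "3 \<le> n" and iso: "digraph_iso (with_proj (graph_square (cycle_graph n))) C"
    using assms(2) by (auto simp: is_cycle_square_def)
  obtain h where "bij_betw h {..<n} (verts C)"
    "\<And>i j. i < n \<Longrightarrow> j < n \<Longrightarrow> (h i, h j) \<in> parcs G \<longleftrightarrow> (i, j) \<in> parcs (graph_square (cycle_graph n))"
    using component_isoE[OF assms(1) iso] by auto
  then show thesis using that[of h] n parcs_square_cycle_graph_iff[OF n] by simp
qed

lemma extendable_K4:
  assumes "complete_digraph 4 C"
  shows "extendable 4 (verts C) (parcs G)"
proof -
  have card: "card (verts C) = 4" using assms by (simp add: complete_digraph_def)
  then have "finite (verts C)" by (intro card_ge_0_finite) simp
  then obtain h :: "nat \<Rightarrow> 'a" where h: "bij_betw h {..<4} (verts C)"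
    using ex_bij_betw_nat_finite[of "verts C"] card by (auto simp: lessThan_atLeast0)
  show ?thesis
  proof (rule extendable_if_bandwidth_less[OF h])
    fix i j :: nat assume ij: "i < 4" "j < 4" "(h i, h j) \<in> parcs G"
    then have "i \<noteq> j" using pair_no_loops[OF ij(3)] by auto
    then show "i \<noteq> j \<and> j < i + 4 \<and> i < j + 4" using ij by simp
  qed simp
qed

lemma equitably_4_choosable:
  assumes "\<And>C. C \<in> components G \<Longrightarrow>
    is_path_square C \<or> (\<exists>n\<ge>6. is_cycle_square n C) \<or> complete_digraph 4 C"
  shows "equitably_choosable G 4"
proof (rule equitably_choosable_if_extendable)
  show "extendable 4 (pverts G) (parcs G)"
  proof (rule extendable_if_components)
    fix C assume C: "C \<in> components G"
    from assms[OF C] show "extendable 4 (verts C) (parcs G)"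
    proof (elim disjE exE conjE)
      assume "is_path_square C"
      then show ?thesis using C by (intro extendable_path_square) auto
    next
      fix n assume n: "6 \<le> n" "is_cycle_square n C"
      obtain h where h: "bij_betw h {..<n} (verts C)"
        "\<And>i j. i < n \<Longrightarrow> j < n \<Longrightarrow> (h i, h j) \<in> parcs G \<longleftrightarrow> cycle_square_adj n i j"
        using component_cycle_squareE[OF C n(2)] by blast
      show ?thesis using extendable_cycle_square_4[OF h(1) n(1)] h(2) by blast
    next
      assume "complete_digraph 4 C"
      then show ?thesis by (rule extendable_K4)
    qed
  qed
qed (use pair_wf_digraph_axioms in auto)

lemma equitably_3_choosable:
  assumes "\<And>C. C \<in> components G \<Longrightarrow>
    is_path_square C \<or> (\<exists>n. is_cycle_square n C \<and> 3 dvd n)"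
  shows "equitably_choosable G 3"
proof (rule equitably_choosable_if_extendable)
  show "extendable 3 (pverts G) (parcs G)"
  proof (rule extendable_if_components)
    fix C assume C: "C \<in> components G"
    from assms[OF C] show "extendable 3 (verts C) (parcs G)"
    proof (elim disjE exE conjE)
      assume "is_path_square C"
      then show ?thesis using C by (intro extendable_path_square) auto
    next
      fix n assume n: "3 dvd n" "is_cycle_square n C"
      obtain h where h: "3 \<le> n" "bij_betw h {..<n} (verts C)"
        "\<And>i j. i < n \<Longrightarrow> j < n \<Longrightarrow> (h i, h j) \<in> parcs G \<longleftrightarrow> cycle_square_adj n i j"
        using component_cycle_squareE[OF C n(2)] by blast
      have "0 < n" using h(1) by simp
      then show ?thesis using extendable_cycle_square_3[OF h(2) n(1)] h(3) by blast
    qed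
  qed
qed (use pair_wf_digraph_axioms in auto)

lemma equitably_3_choosable_imp_not_K4:
  assumes "equitably_choosable G 3" "C \<in> components G"
  shows "\<not> complete_digraph 4 C"
proof
  assume K: "complete_digraph 4 C"
  obtain f :: "'a \<Rightarrow> nat" where f: "\<And>v. v \<in> pverts G \<Longrightarrow> f v < 3" "\<And>u v. (u, v) \<in> parcs G \<Longrightarrow> f u \<noteq> f v"
    using equitably_choosable_imp_colorable[OF assms(1)] by auto
  have ind: "induced_subgraph C (with_proj G)" using assms(2) by (rule component_induced)
  have sub: "verts C \<subseteq> pverts G" using ind by (auto simp: induced_subgraph_def subgraph_def)
  have ends: "arcs_ends C \<subseteq> parcs G"
    using ind by (auto simp: induced_subgraph_def subgraph_def compatible_def arcs_ends_conv)
  have "inj_on f (verts C)"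
  proof (rule inj_onI, rule ccontr)
    fix u v assume uv: "u \<in> verts C" "v \<in> verts C" "f u = f v" "u \<noteq> v"
    then have "(u, v) \<in> arcs_ends C" using K by (simp add: complete_digraph_def)
    then show False using ends f(2) uv(3) by blast
  qed
  then have "card (verts C) \<le> card {..<3 :: nat}"
    using f(1) sub by (intro card_inj_on_le[of f]) auto
  then show False using K by (simp add: complete_digraph_def)
qed

lemma equitably_3_choosable_imp_3_dvd:
  assumes "equitably_choosable G 3" "C \<in> components G" "is_cycle_square n C"
  shows "3 dvd n"
proof -
  obtain f :: "'a \<Rightarrow> nat" where f: "\<And>v. v \<in> pverts G \<Longrightarrow> f v < 3" "\<And>u v. (u, v) \<in> parcs G \<Longrightarrow> f u \<noteq> f v"
    using equitably_choosable_imp_colorable[OF assms(1)] by auto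
  obtain h where h: "3 \<le> n" "bij_betw h {..<n} (verts C)"
    "\<And>i j. i < n \<Longrightarrow> j < n \<Longrightarrow> (h i, h j) \<in> parcs G \<longleftrightarrow> cycle_square_adj n i j"
    using component_cycle_squareE[OF assms(2,3)] by blast
  have "h i \<in> pverts G" if "i < n" for i
    using that h(2) assms(2) Union_verts_components by (auto simp: bij_betw_def)
  then show ?thesis
    using h f by (intro cycle_square_3_colorable_imp_3_dvd[of n "\<lambda>i. f (h i)"]) auto
qed

lemma card_component_cycle_square:
  assumes "C \<in> components G" "is_cycle_square n C"
  shows "card (verts C) = n"
  using component_cycle_squareE[OF assms] by (metis bij_betw_same_card card_lessThan)

end

theorem theorem17:
  fixes G :: "'a pair_pre_digraph"
  assumes "pair_graph G"
    and "\<forall>C\<in>components G.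
           is_path_square C \<or> (\<exists>n\<ge>6. is_cycle_square n C) \<or> complete_digraph 4 C"
  shows "equitably_choosable G 4 \<and>
         (equitably_choosable G 3 \<longleftrightarrow>
            (\<forall>C\<in>components G. \<not> complete_digraph 4 C) \<and>
            (\<forall>C\<in>components G. (\<exists>n. is_cycle_square n C) \<longrightarrow> 3 dvd card (verts C)))"
proof (intro conjI iffI)
  interpret pair_graph G by fact
  show "equitably_choosable G 4"
    using assms(2) by (intro equitably_4_choosable) blast
  show "\<forall>C\<in>components G. \<not> complete_digraph 4 C" if "equitably_choosable G 3"
    using equitably_3_choosable_imp_not_K4[OF that] by blast
  \<comment> \<open>Necessity is proved for every \<open>n\<close> from 3 on, since a triangle is
    also the square of a 3-cycle and \<open>K_4\<close> that of a 4-cycle.\<close>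
  show "\<forall>C\<in>components G. (\<exists>n. is_cycle_square n C) \<longrightarrow> 3 dvd card (verts C)" if "equitably_choosable G 3"
    using equitably_3_choosable_imp_3_dvd[OF that] card_component_cycle_square by auto
  show "equitably_choosable G 3" if *: "(\<forall>C\<in>components G. \<not> complete_digraph 4 C) \<and>
      (\<forall>C\<in>components G. (\<exists>n. is_cycle_square n C) \<longrightarrow> 3 dvd card (verts C))"
  proof (rule equitably_3_choosable)
    fix C assume C: "C \<in> components G"
    then consider "is_path_square C" | n where "is_cycle_square n C" using assms(2) * by blast
    then show "is_path_square C \<or> (\<exists>n. is_cycle_square n C \<and> 3 dvd n)"
    proof cases
      case 2
      then have "3 dvd n" using * C card_component_cycle_square[OF C 2] by auto
      then show ?thesis using 2 by blast
    qed simp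
  qed
qed

end
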